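(* Let $x\in\mathcal D_{\varepsilon_1,\varepsilon_3}$ for some $\varepsilon_1,\varepsilon_3>0$ and let $g$ be an admissible window function with $\int_{\mathbb R}g(\tau)\,d\tau=1$ and $I_1,I_3<\infty$. Let $\tau_0\in(0,1)$, and suppose that there is a function $\sigma(t)>0$, $t\in\mathbb R$, such that $$O_k\cap O_\ell=\emptyset\quad\text{for all } k\neq \ell,\ 0\le k,\ell\le K,$$ and that $\varepsilon_1,\varepsilon_3,\tau_0$ are small enough that for all $t\in\mathbb R$ and $0\le \ell\le K$ $$\mathrm{Err}_\ell(t)<\tfrac12|G_\ell(0)|A_\ell(t),\qquad 2M(t)\big(\tau_0+\Pi_0(t)\big)\le g_0(t)\mu(t).$$ Let $\widetilde\epsilon_1=\widetilde\epsilon_1(t)$ be a function satisfying $$M(t)\big(\tau_0+\Pi_0(t)\big)\le\widetilde\epsilon_1(t)\le g_0(t)\mu(t)-M(t)\big(\tau_0+\Pi_0(t)\big).$$ Let $\mathcal G_t$, $\mathcal H_{t,k}$ and $\check\eta_\ell(t)$ be defined with this $\widetilde\epsilon_1$ (see context). Then for every $t\in\mathbb R$: (a) $\mathcal G_t$ is the disjoint union of exactly the $K+1$ non-empty sets $\mathcal H_{t,k}$, $0\le k\le K$. (b) For $\ell=1,\dots,K$, $$|\check\eta_\ell(t)-\phi_\ell'(t)|\le \frac1{\sigma(t)}\,|G_\ell|^{-1}\Big(|G_\ell(0)|-\frac{2\,\mathrm{Err}_\ell(t)}{A_\ell(t)}\Big).$$ (c) For $\ell=0,1,\dots,K$, $$\big|\widetilde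 V_x(t,\check\eta_\ell(t))-G_\ell(0)\,x_\ell(t)\big|\le \mathrm{Err}_\ell(t)+2\pi I_1A_\ell(t)\,|G_\ell|^{-1}\Big(|G_\ell(0)|-\frac{2\,\mathrm{Err}_\ell(t)}{A_\ell(t)}\Big).$$
   Context: **Signals.** $x(t)=A_0(t)+\sum_{k=1}^K x_k(t)$ with $x_k(t)=A_k(t)e^{i2\pi\phi_k(t)}$, $t\in\mathbb R$; put $\phi_0\equiv0$ and $x_0(t)=A_0(t)$. For $\varepsilon_1,\varepsilon_3>0$, $\mathcal D_{\varepsilon_1,\varepsilon_3}$ is the set of such $x$ for which: - $A_k(t)>0$ ($0\le k\le K$); - for $1\le k\le K$: $\phi_k\in C^3(\mathbb R)$, $\phi_k''\in L_\infty(\mathbb R)$, $\inf_{t}\phi_k'(t)>0$, $\sup_t\phi_k'(t)<\infty$; - $\min_{2\le k\le K}\inf_{t\in\mathbb R}(\phi_k'(t)-\phi_{k-1}'(t))>0$; - $|A_k(t+\tau)-A_k(t)|\le\varepsilon_1|\tau|A_k(t)$ for all $t,\tau\in\mathbb R$, $0\le k\le K$; - $|\phi_k^{(3)}(t)|\le\varepsilon_3$ for all $t\in\mathbb R$, $1\le k\le K$. $\mu(t)=\min_{0\le k\le K}A_k(t)$, $M(t)=\sum_{k=0}^KA_k(t)$. Sums $\sum_{k\ne\ell}$ are over $0\le k\le K$, $k\ne\ell$. **Adaptive STFT.** For $\sigma(t)>0$ and window $g$, $$\widetilde V_x(t,\eta)=\int_{\mathbb R}x(t+\tau)\frac1{\sigma(t)}g\Big(\frac{\tau}{\sigma(t)}\Big)e^{-i2\pi\eta\tau}\,d\tau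 .$$ **Admissible window.** $g\in L_1(\mathbb R)\cap L_2(\mathbb R)$ is admissible if for every $\lambda\in\mathbb R$ the modulus of $\xi\mapsto\int_{\mathbb R}g(\tau)e^{-i2\pi\xi\tau-i\pi\lambda\tau^2}d\tau$ is even in $\xi$ and (strictly) decreasing for $\xi\ge0$. Let $I_n=\int_{\mathbb R}|\tau^ng(\tau)|\,d\tau$. **Functions $G_k$.** For fixed $t$ and $0\le k\le K$, $$G_k(\xi)=\int_{\mathbb R}e^{i\pi\sigma^2(t)\phi_k''(t)\tau^2}g(\tau)e^{-i2\pi\xi\tau}\,d\tau$$ (it depends on $t$). $|G_k|^{-1}$ denotes the inverse function of $\xi\mapsto|G_k(\xi)|$, $\xi\ge0$ (not a reciprocal). $g_0(t)=\min_{0\le k\le K}|G_k(0)|$. **Zones.** Given the threshold $\tau_0\in(0,1)$, $\xi_k(t)>0$ is the unique solution of $|G_k(\xi_k)|=\tau_0$, and $\alpha_k=\alpha_k(t)$ are chosen functions with $\alpha_k(t)\ge\xi_k(t)$. Set $$O_k=\{(t,\eta):\ |\eta-\phi_k'(t)|<\alpha_k(t)/\sigma(t),\ t\in\mathbb R\}.$$ **Error quantities.** $\Pi_0(t)=\varepsilon_1I_1\sigma(t)+\frac\pi3\varepsilon_3I_3\sigma^3(t)$; $\Upsilon_{k,\ell}=\alpha_k+\alpha_\ell+2\sum_{\min(k,\ell)<j<\max(k,\ell)}\alpha_j$ for $k\ne\ell$; $$\mathrm{Err}_\ell(t)=M(t)\Pi_0(t)+\sum_{k\ne\ell}A_k(t)\,|G_k(\Upsilon_{k,\ell}-\alpha_\ell)|.$$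 **Ridge sets and ridges.** For $\widetilde\epsilon_1(t)>0$: $\mathcal G_t=\{\eta\in\mathbb R:|\widetilde V_x(t,\eta)|>\widetilde\epsilon_1(t)\}$, $\mathcal H_{t,k}=\{\eta\in\mathcal G_t:|\eta-\phi_k'(t)|<\alpha_k(t)/\sigma(t)\}$. Put $\check\eta_0(t)=0$ and, for $1\le\ell\le K$, $\check\eta_\ell(t)$ is a maximizer of $\eta\mapsto|\widetilde V_x(t,\eta)|$ over $\mathcal H_{t,\ell}$. *)

theory Defs
  imports "HOL-Analysis.Analysis"
begin

text \<open>
  A signal is given by its data \<open>K\<close>, \<open>A\<close>, \<open>\<phi>\<close>: amplitudes \<open>A 0, \<dots>, A K\<close> and phases
  \<open>\<phi> 0, \<dots>, \<phi> K\<close>, where \<open>\<phi> 0\<close> is identically zero on the signal class below, so that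
  \<open>component A \<phi> 0\<close> is the trend \<open>A 0\<close>.
\<close>

definition component :: "(nat \<Rightarrow> real \<Rightarrow> real) \<Rightarrow> (nat \<Rightarrow> real \<Rightarrow> real) \<Rightarrow> nat \<Rightarrow> real \<Rightarrow> complex"
  where "component A \<phi> k t = of_real (A k t) * cis (2 * pi * \<phi> k t)"

definition signal :: "nat \<Rightarrow> (nat \<Rightarrow> real \<Rightarrow> real) \<Rightarrow> (nat \<Rightarrow> real \<Rightarrow> real) \<Rightarrow> real \<Rightarrow> complex"
  where "signal K A \<phi> t = of_real (A 0 t) + (\<Sum>k=1..K. component A \<phi> k t)"

definition C_n :: "nat \<Rightarrow> (real \<Rightarrow> real) \<Rightarrow> bool"
  where "C_n n f \<longleftrightarrow>
    (\<forall>m<n. (deriv ^^ m) f differentiable_on UNIV) \<and> continuous_on UNIV ((deriv ^^ n) f)"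

text \<open>
  Infima and suprema are taken in the extended reals, where they exist for every function; on
  \<^typ>\<open>real\<close> they are unspecified for unbounded ones.  For fewer than two oscillating
  components the separation condition is void.
\<close>

definition signal_class ::
  "real \<Rightarrow> real \<Rightarrow> nat \<Rightarrow> (nat \<Rightarrow> real \<Rightarrow> real) \<Rightarrow> (nat \<Rightarrow> real \<Rightarrow> real) \<Rightarrow> bool"
  where "signal_class \<epsilon>\<^sub>1 \<epsilon>\<^sub>3 K A \<phi> \<longleftrightarrow>
    \<phi> 0 = (\<lambda>_. 0) \<and>
    (\<forall>k\<in>{0..K}. \<forall>t. A k t > 0) \<and>
    (\<forall>k\<in>{1..K}. C_n 3 (\<phi> k) \<and>
       (\<exists>C. AE t in lebesgue. \<bar>(deriv ^^ 2) (\<phi> k) t\<bar> \<le> C) \<and>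
       (INF t. ereal (deriv (\<phi> k) t)) > 0 \<and>
       (SUP t. ereal (deriv (\<phi> k) t)) < \<infinity>) \<and>
    (\<forall>k\<in>{2..K}. (INF t. ereal (deriv (\<phi> k) t - deriv (\<phi> (k - 1)) t)) > 0) \<and>
    (\<forall>k\<in>{0..K}. \<forall>t \<tau>. \<bar>A k (t + \<tau>) - A k t\<bar> \<le> \<epsilon>\<^sub>1 * \<bar>\<tau>\<bar> * A k t) \<and>
    (\<forall>k\<in>{1..K}. \<forall>t. \<bar>(deriv ^^ 3) (\<phi> k) t\<bar> \<le> \<epsilon>\<^sub>3)"

definition min_amp :: "nat \<Rightarrow> (nat \<Rightarrow> real \<Rightarrow> real) \<Rightarrow> real \<Rightarrow> real"
  where "min_amp K A t = Min ((\<lambda>k. A k t) ` {0..K})"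

definition sum_amp :: "nat \<Rightarrow> (nat \<Rightarrow> real \<Rightarrow> real) \<Rightarrow> real \<Rightarrow> real"
  where "sum_amp K A t = (\<Sum>k=0..K. A k t)"

definition adaptive_stft ::
  "(real \<Rightarrow> complex) \<Rightarrow> (real \<Rightarrow> real) \<Rightarrow> (real \<Rightarrow> complex) \<Rightarrow> real \<Rightarrow> real \<Rightarrow> complex"
  where "adaptive_stft g \<sigma> x t \<eta> =
    (LINT \<tau>|lebesgue. x (t + \<tau>) * of_real (1 / \<sigma> t) * g (\<tau> / \<sigma> t) * cis (- 2 * pi * \<eta> * \<tau>))"

definition admissible_window :: "(real \<Rightarrow> complex) \<Rightarrow> bool"
  where "admissible_window g \<longleftrightarrow>
    integrable lebesgue g \<and> integrable lebesgue (\<lambda>\<tau>. (norm (g \<tau>))\<^sup>2) \<and>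
    (\<forall>c::real. let F = (\<lambda>\<xi>. norm (LINT \<tau>|lebesgue. g \<tau> * cis (- 2 * pi * \<xi> * \<tau> - pi * c * \<tau>\<^sup>2)))
       in (\<forall>\<xi>. F (- \<xi>) = F \<xi>) \<and> strict_antimono_on {0..} F)"

definition abs_moment :: "(real \<Rightarrow> complex) \<Rightarrow> nat \<Rightarrow> real"
  where "abs_moment g n = (LINT \<tau>|lebesgue. norm (of_real (\<tau> ^ n) * g \<tau>))"

definition finite_abs_moment :: "(real \<Rightarrow> complex) \<Rightarrow> nat \<Rightarrow> bool"
  where "finite_abs_moment g n \<longleftrightarrow> integrable lebesgue (\<lambda>\<tau>. norm (of_real (\<tau> ^ n) * g \<tau>))"

definition G ::
  "(real \<Rightarrow> complex) \<Rightarrow> (real \<Rightarrow> real) \<Rightarrow> (nat \<Rightarrow> real \<Rightarrow> real) \<Rightarrow> nat \<Rightarrow> real \<Rightarrow> real \<Rightarrow> complex"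
  where "G g \<sigma> \<phi> k t \<xi> =
    (LINT \<tau>|lebesgue. cis (pi * (\<sigma> t)\<^sup>2 * (deriv ^^ 2) (\<phi> k) t * \<tau>\<^sup>2) * g \<tau> * cis (- 2 * pi * \<xi> * \<tau>))"

text \<open>The inverse function of \<open>\<xi> \<mapsto> \<bar>G\<^sub>k(\<xi>)\<bar>\<close> on \<open>\<xi> \<ge> 0\<close>, not a reciprocal.\<close>

definition abs_G_inv ::
  "(real \<Rightarrow> complex) \<Rightarrow> (real \<Rightarrow> real) \<Rightarrow> (nat \<Rightarrow> real \<Rightarrow> real) \<Rightarrow> nat \<Rightarrow> real \<Rightarrow> real \<Rightarrow> real"
  where "abs_G_inv g \<sigma> \<phi> k t = the_inv_into {0..} (\<lambda>\<xi>. norm (G g \<sigma> \<phi> k t \<xi>))"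

definition min_G0 ::
  "(real \<Rightarrow> complex) \<Rightarrow> (real \<Rightarrow> real) \<Rightarrow> nat \<Rightarrow> (nat \<Rightarrow> real \<Rightarrow> real) \<Rightarrow> real \<Rightarrow> real"
  where "min_G0 g \<sigma> K \<phi> t = Min ((\<lambda>k. norm (G g \<sigma> \<phi> k t 0)) ` {0..K})"

text \<open>
  For an admissible window the solution is unique, and it exists whenever
  \<open>0 < \<tau>\<^sub>0 < \<bar>G\<^sub>k(0)\<bar>\<close> (monotonicity, continuity and the Riemann-Lebesgue lemma).
\<close>

definition essential_radius ::
  "(real \<Rightarrow> complex) \<Rightarrow> (real \<Rightarrow> real) \<Rightarrow> (nat \<Rightarrow> real \<Rightarrow> real) \<Rightarrow> real \<Rightarrow> nat \<Rightarrow> real \<Rightarrow> real"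
  where "essential_radius g \<sigma> \<phi> \<tau>\<^sub>0 k t = (THE \<xi>. \<xi> > 0 \<and> norm (G g \<sigma> \<phi> k t \<xi>) = \<tau>\<^sub>0)"

definition zone ::
  "(real \<Rightarrow> real) \<Rightarrow> (nat \<Rightarrow> real \<Rightarrow> real) \<Rightarrow> (nat \<Rightarrow> real \<Rightarrow> real) \<Rightarrow> nat \<Rightarrow> (real \<times> real) set"
  where "zone \<sigma> \<phi> \<alpha> k = {(t, \<eta>). \<bar>\<eta> - deriv (\<phi> k) t\<bar> < \<alpha> k t / \<sigma> t}"

definition Pi0 :: "(real \<Rightarrow> complex) \<Rightarrow> (real \<Rightarrow> real) \<Rightarrow> real \<Rightarrow> real \<Rightarrow> real \<Rightarrow> real"
  where "Pi0 g \<sigma> \<epsilon>\<^sub>1 \<epsilon>\<^sub>3 t =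
    \<epsilon>\<^sub>1 * abs_moment g 1 * \<sigma> t + pi / 3 * \<epsilon>\<^sub>3 * abs_moment g 3 * (\<sigma> t) ^ 3"

definition Upsilon :: "(nat \<Rightarrow> real \<Rightarrow> real) \<Rightarrow> real \<Rightarrow> nat \<Rightarrow> nat \<Rightarrow> real"
  where "Upsilon \<alpha> t k l = \<alpha> k t + \<alpha> l t + 2 * (\<Sum>j\<in>{min k l<..<max k l}. \<alpha> j t)"

definition Err ::
  "(real \<Rightarrow> complex) \<Rightarrow> (real \<Rightarrow> real) \<Rightarrow> real \<Rightarrow> real \<Rightarrow> nat \<Rightarrow> (nat \<Rightarrow> real \<Rightarrow> real) \<Rightarrow>
   (nat \<Rightarrow> real \<Rightarrow> real) \<Rightarrow> (nat \<Rightarrow> real \<Rightarrow> real) \<Rightarrow> nat \<Rightarrow> real \<Rightarrow> real"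
  where "Err g \<sigma> \<epsilon>\<^sub>1 \<epsilon>\<^sub>3 K A \<phi> \<alpha> l t =
    sum_amp K A t * Pi0 g \<sigma> \<epsilon>\<^sub>1 \<epsilon>\<^sub>3 t +
    (\<Sum>k\<in>{0..K} - {l}. A k t * norm (G g \<sigma> \<phi> k t (Upsilon \<alpha> t k l - \<alpha> l t)))"

definition ridge_set ::
  "(real \<Rightarrow> complex) \<Rightarrow> (real \<Rightarrow> real) \<Rightarrow> (real \<Rightarrow> complex) \<Rightarrow> (real \<Rightarrow> real) \<Rightarrow> real \<Rightarrow> real set"
  where "ridge_set g \<sigma> x thr t = {\<eta>. norm (adaptive_stft g \<sigma> x t \<eta>) > thr t}"

definition ridge_zone ::
  "(real \<Rightarrow> complex) \<Rightarrow> (real \<Rightarrow> real) \<Rightarrow> (real \<Rightarrow> complex) \<Rightarrow> (real \<Rightarrow> real) \<Rightarrow>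
   (nat \<Rightarrow> real \<Rightarrow> real) \<Rightarrow> (nat \<Rightarrow> real \<Rightarrow> real) \<Rightarrow> real \<Rightarrow> nat \<Rightarrow> real set"
  where "ridge_zone g \<sigma> x thr \<phi> \<alpha> t k =
    {\<eta> \<in> ridge_set g \<sigma> x thr t. \<bar>\<eta> - deriv (\<phi> k) t\<bar> < \<alpha> k t / \<sigma> t}"

definition is_ridges ::
  "(real \<Rightarrow> complex) \<Rightarrow> (real \<Rightarrow> real) \<Rightarrow> (real \<Rightarrow> complex) \<Rightarrow> (real \<Rightarrow> real) \<Rightarrow> nat \<Rightarrow>
   (nat \<Rightarrow> real \<Rightarrow> real) \<Rightarrow> (nat \<Rightarrow> real \<Rightarrow> real) \<Rightarrow> (nat \<Rightarrow> real \<Rightarrow> real) \<Rightarrow> real \<Rightarrow> bool"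
  where "is_ridges g \<sigma> x thr K \<phi> \<alpha> etac t \<longleftrightarrow>
    etac 0 t = 0 \<and>
    (\<forall>l\<in>{1..K}. is_arg_max (\<lambda>\<eta>. norm (adaptive_stft g \<sigma> x t \<eta>))
       (\<lambda>\<eta>. \<eta> \<in> ridge_zone g \<sigma> x thr \<phi> \<alpha> t l) (etac l t))"

end

theory Submission
  imports Defs
begin

text \<open>
  Near a time \<open>t\<close> each component looks like a linear chirp: its amplitude is almost constant
  and, by Taylor's formula, its phase is almost quadratic.  The adaptive transform of that chirp is
  exactly \<open>x\<^sub>k(t) G\<^sub>k(\<sigma>(t)(\<eta> - \<phi>\<^sub>k'(t)))\<close>, so by linearity
  \<open>V(t,\<eta>)\<close> is the sum over \<open>k\<close> of these terms up to an error of at most \<open>M(t) \<Pi>\<^sub>0(t)\<close>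
  (lemma \<open>stft_approx\<close>).  Admissibility of the window makes \<open>\<bar>G\<^sub>k\<bar>\<close> even and strictly
  decreasing on the half line, so the size of a term is governed by the distance of \<open>\<eta>\<close> from the
  frequency \<open>\<phi>\<^sub>k'(t)\<close>.

  The zones are open intervals of radius \<open>\<alpha>\<^sub>k/\<sigma>\<close> about the increasing frequencies.  Their
  disjointness yields \<open>\<sigma>\<bar>\<phi>\<^sub>l' - \<phi>\<^sub>k'\<bar> \<ge> \<Upsilon>\<^sub>k\<^sub>l\<close>
  (\<open>Upsilon_le_frequency_gap\<close>), because the zones in between have to fit into the gap.  Three
  estimates follow.  Outside all zones every term is at most \<open>A\<^sub>k \<tau>\<^sub>0\<close>, so \<open>\<bar>V\<bar>\<close> is
  at most the threshold.  At the frequency \<open>\<phi>\<^sub>l'\<close> the \<open>l\<close>-th term has size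
  \<open>A\<^sub>l \<bar>G\<^sub>l(0)\<bar>\<close> and the others are at most \<open>A\<^sub>k \<tau>\<^sub>0\<close>, so \<open>\<bar>V\<bar>\<close> exceeds the
  threshold; together these give the decomposition of the ridge set.  Throughout the \<open>l\<close>-th
  zone, \<open>V\<close> differs from its \<open>l\<close>-th term by at most \<open>Err\<^sub>l\<close>
  (\<open>stft_approx_in_zone\<close>).

  Comparing the maximizer of \<open>\<bar>V\<bar>\<close> in the \<open>l\<close>-th zone with the competitor
  \<open>\<phi>\<^sub>l'\<close> then shows \<open>\<bar>G\<^sub>l\<bar> \<ge> \<bar>G\<^sub>l(0)\<bar> - 2 Err\<^sub>l / A\<^sub>l\<close> at the maximizer, and
  monotonicity turns this into the bound on its distance from \<open>\<phi>\<^sub>l'\<close> (\<open>peak_deviation\<close>).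
  Replacing \<open>G\<^sub>l\<close> there by \<open>G\<^sub>l(0)\<close> recovers the component; besides \<open>Err\<^sub>l\<close> it costs
  \<open>A\<^sub>l\<close> times the Lipschitz constant \<open>2\<pi>I\<^sub>1\<close> of \<open>G\<^sub>l\<close> times \<open>\<sigma>\<close> times that distance
  (\<open>component_recovery\<close>).

  Both the radii \<open>\<xi>\<^sub>k\<close> and the inverse functions of \<open>\<bar>G\<^sub>k\<bar>\<close> have meaning only where
  \<open>\<bar>G\<^sub>k\<bar>\<close> attains the value in question.  By the intermediate value theorem this needs
  \<open>\<bar>G\<^sub>k\<bar>\<close> to take arbitrarily small values, a weak form of the Riemann-Lebesgue lemma that is
  derived from Bessel's inequality, as the window is square integrable (\<open>fourier_attains\<close>).
\<close>

section \<open>Fourier transforms of square integrable functions\<close>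

definition fourier :: "(real \<Rightarrow> complex) \<Rightarrow> real \<Rightarrow> complex"
  where "fourier h \<xi> = (LINT \<tau>|lebesgue. h \<tau> * cis (- 2 * pi * \<xi> * \<tau>))"

lemma norm_cis_diff_le: "norm (cis a - cis b) \<le> \<bar>a - b\<bar>"
proof -
  have "cis a - cis b = cis b * (cis (a - b) - 1)"
    by (simp add: algebra_simps cis_mult)
  then have "norm (cis a - cis b) = 2 * \<bar>sin ((a - b) / 2)\<bar>"
    using dist_exp_i_1[of "a - b"] by (simp add: norm_mult cis_conv_exp)
  also have "\<dots> \<le> \<bar>a - b\<bar>"
    using abs_sin_x_le_abs_x[of "(a - b) / 2"] by simp
  finally show ?thesis .
qed

lemma measurable_cis_lebesgue:
  assumes "continuous_on UNIV f"
  shows "(\<lambda>\<tau>::real. cis (f \<tau>)) \<in> borel_measurable lebesgue"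
proof -
  have "(\<lambda>\<tau>::real. cis (f \<tau>)) \<in> borel_measurable borel"
    by (intro borel_measurable_continuous_onI continuous_intros assms)
  then show ?thesis by (simp add: measurable_completion)
qed

lemma integrable_mult_unimodular:
  fixes h u :: "'a \<Rightarrow> complex"
  assumes "integrable M h" "u \<in> borel_measurable M" "\<And>x. norm (u x) = 1"
  shows "integrable M (\<lambda>x. h x * u x)"
  by (rule Bochner_Integration.integrable_bound[OF assms(1)])
     (use assms in \<open>auto simp: norm_mult\<close>)

text \<open>
  The exponentials at two frequencies differ by at most the difference of their phases, which is
  \<open>2\<pi>\<bar>a - b\<bar> \<bar>\<tau>\<bar>\<close>; so a first moment suffices for Lipschitz continuity.
\<close>

lemma fourier_lipschitz:
  assumes h: "integrable lebesgue h" and moment: "integrable lebesgue (\<lambda>\<tau>. \<tau> *\<^sub>R h \<tau>)"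
  shows "norm (fourier h a - fourier h b)
    \<le> 2 * pi * \<bar>a - b\<bar> * (LINT \<tau>|lebesgue. norm (\<tau> *\<^sub>R h \<tau>))"
proof -
  have int: "integrable lebesgue (\<lambda>\<tau>. h \<tau> * cis (- 2 * pi * \<xi> * \<tau>))" for \<xi>
    by (intro integrable_mult_unimodular h measurable_cis_lebesgue continuous_intros) simp
  have "norm (fourier h a - fourier h b) =
      norm (LINT \<tau>|lebesgue. h \<tau> * cis (- 2 * pi * a * \<tau>) - h \<tau> * cis (- 2 * pi * b * \<tau>))"
    unfolding fourier_def by (subst Bochner_Integration.integral_diff) (use int in auto)
  also have "\<dots> \<le> (LINT \<tau>|lebesgue. 2 * pi * \<bar>a - b\<bar> * norm (\<tau> *\<^sub>R h \<tau>))"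
  proof (rule Bochner_Integration.integral_norm_bound_integral)
    fix \<tau> :: real
    have "norm (h \<tau> * cis (- 2 * pi * a * \<tau>) - h \<tau> * cis (- 2 * pi * b * \<tau>)) =
        norm (h \<tau>) * norm (cis (- 2 * pi * a * \<tau>) - cis (- 2 * pi * b * \<tau>))"
      by (simp add: norm_mult flip: right_diff_distrib)
    also have "\<dots> \<le> norm (h \<tau>) * \<bar>- 2 * pi * a * \<tau> - (- 2 * pi * b * \<tau>)\<bar>"
      by (intro mult_left_mono norm_cis_diff_le) simp
    also have "- 2 * pi * a * \<tau> - (- 2 * pi * b * \<tau>) = (- 2 * pi) * ((a - b) * \<tau>)"
      by (simp add: algebra_simps)
    also have "\<bar>(- 2 * pi) * ((a - b) * \<tau>)\<bar> = 2 * pi * (\<bar>a - b\<bar> * \<bar>\<tau>\<bar>)"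
      by (simp add: abs_mult)
    finally show "norm (h \<tau> * cis (- 2 * pi * a * \<tau>) - h \<tau> * cis (- 2 * pi * b * \<tau>))
        \<le> 2 * pi * \<bar>a - b\<bar> * norm (\<tau> *\<^sub>R h \<tau>)"
      by (simp add: mult_ac)
  qed (use int integrable_norm[OF moment] in auto)
  finally show ?thesis by simp
qed

text \<open>
  The orthogonal projection \<open>S\<close> of \<open>h\<close> onto the span of the \<open>e\<^sub>i\<close> leaves a residual orthogonal
  to \<open>S\<close>, so the squared norm of the residual, which cannot be negative, is that of \<open>h\<close> minus the sum
  of the squared coefficients over \<open>P\<close>.
\<close>

lemma bessel_inequality:
  fixes h :: "'a \<Rightarrow> complex" and e :: "'i \<Rightarrow> 'a \<Rightarrow> complex"
  assumes M: "finite_measure M"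
    and h: "integrable M h" and h2: "integrable M (\<lambda>x. (norm (h x))\<^sup>2)"
    and e: "\<And>i. e i \<in> borel_measurable M" "\<And>i x. norm (e i x) = 1"
    and orth: "\<And>i j. i \<in> I \<Longrightarrow> j \<in> I \<Longrightarrow> (LINT x|M. e i x * cnj (e j x)) = (if i = j then of_real P else 0)"
    and I: "finite I" and P: "P > 0"
  shows "(\<Sum>i\<in>I. (norm (LINT x|M. h x * cnj (e i x)))\<^sup>2) \<le> P * (LINT x|M. (norm (h x))\<^sup>2)"
proof -
  interpret finite_measure M by fact
  note [measurable] = e(1) borel_measurable_integrable[OF h]
  define c where "c i = (LINT x|M. h x * cnj (e i x))" for i
  define S where "S x = (\<Sum>i\<in>I. c i / P * e i x)" for x
  have cnj_meas [measurable]: "(\<lambda>x. cnj (f x)) \<in> borel_measurable M"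
    if "f \<in> borel_measurable M" for f
    using that by (rule borel_measurable_continuous_on[rotated]) (intro continuous_intros)
  have int_e: "integrable M (\<lambda>x. f x * cnj (e i x))" if "integrable M f" for f i
    by (rule integrable_mult_unimodular[OF that]) (use e in auto)
  have int_e': "integrable M (e i)" for i
    by (rule integrable_const_bound[of _ 1]) (use e in auto)
  have int_S: "integrable M S"
    unfolding S_def by (intro Bochner_Integration.integrable_sum integrable_mult_right int_e')
  have int_hh: "integrable M (\<lambda>x. h x * cnj (h x))"
    using integrable_of_real[OF h2, where 'a = complex]
    by (simp add: complex_norm_square del: of_real_power)
  have coeff: "(LINT x|M. S x * cnj (e j x)) = c j" if j: "j \<in> I" for j
  proof -
    have "(LINT x|M. S x * cnj (e j x)) = (LINT x|M. (\<Sum>i\<in>I. c i / P * (e i x * cnj (e j x))))"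
      by (simp add: S_def sum_distrib_right mult.assoc)
    also have "\<dots> = (\<Sum>i\<in>I. c i / P * (LINT x|M. e i x * cnj (e j x)))"
      by (subst Bochner_Integration.integral_sum)
         (simp_all only: integral_mult_right_zero integrable_mult_right int_e[OF int_e'])
    also have "\<dots> = (\<Sum>i\<in>I. if i = j then c i else 0)"
      using P j by (intro sum.cong) (auto simp: orth)
    also have "\<dots> = c j" using I j by simp
    finally show ?thesis .
  qed
  have res_e: "(LINT x|M. (h x - S x) * cnj (e j x)) = 0" if "j \<in> I" for j
    using coeff[OF that] unfolding left_diff_distrib
    by (subst Bochner_Integration.integral_diff) (auto intro: int_e h int_S simp: c_def)
  have int_res: "integrable M (\<lambda>x. h x - S x)" by (intro Bochner_Integration.integrable_diff h int_S)
  have cnjS: "cnj (S x) = (\<Sum>i\<in>I. cnj (c i / P) * cnj (e i x))" for x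
    by (simp add: S_def)
  have int_fS: "integrable M (\<lambda>x. f x * cnj (S x))" if "integrable M f" for f
  proof -
    have "integrable M (\<lambda>x. \<Sum>i\<in>I. cnj (c i / P) * (f x * cnj (e i x)))"
      by (intro Bochner_Integration.integrable_sum integrable_mult_right int_e that)
    then show ?thesis by (simp add: cnjS sum_distrib_left mult_ac)
  qed
  have res_S: "(LINT x|M. (h x - S x) * cnj (S x)) = 0"
  proof -
    have "(LINT x|M. (h x - S x) * cnj (S x)) =
        (LINT x|M. (\<Sum>i\<in>I. cnj (c i / P) * ((h x - S x) * cnj (e i x))))"
      by (simp add: cnjS sum_distrib_left mult_ac)
    also have "\<dots> = (\<Sum>i\<in>I. cnj (c i / P) * (LINT x|M. (h x - S x) * cnj (e i x)))"
      by (subst Bochner_Integration.integral_sum) 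
         (simp_all only: integral_mult_right_zero integrable_mult_right int_e[OF int_res])
    also have "\<dots> = 0" by (simp add: res_e)
    finally show ?thesis .
  qed
  have h_S: "(LINT x|M. h x * cnj (S x)) = of_real ((\<Sum>i\<in>I. (norm (c i))\<^sup>2) / P)"
  proof -
    have "(LINT x|M. h x * cnj (S x)) = (LINT x|M. (\<Sum>i\<in>I. cnj (c i / P) * (h x * cnj (e i x))))"
      by (simp add: cnjS sum_distrib_left mult_ac)
    also have "\<dots> = (\<Sum>i\<in>I. cnj (c i / P) * c i)"
      by (subst Bochner_Integration.integral_sum) 
         (simp_all only: integral_mult_right_zero integrable_mult_right int_e[OF h] c_def[symmetric])
    also have "\<dots> = of_real ((\<Sum>i\<in>I. (norm (c i))\<^sup>2) / P)"
      unfolding of_real_divide of_real_sum sum_divide_distrib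
      by (intro sum.cong) (auto simp: complex_norm_square simp del: of_real_power)
    finally show ?thesis .
  qed
  have int_Sh: "integrable M (\<lambda>x. S x * cnj (h x))"
    using integrable_cnj[OF int_fS[OF h]] by (simp add: mult_ac)
  have S_h: "(LINT x|M. S x * cnj (h x)) = of_real ((\<Sum>i\<in>I. (norm (c i))\<^sup>2) / P)"
  proof -
    have "(LINT x|M. S x * cnj (h x)) = (LINT x|M. cnj (h x * cnj (S x)))"
      by (simp add: mult_ac)
    also have "\<dots> = cnj (LINT x|M. h x * cnj (S x))" by (rule Bochner_Integration.integral_cnj)
    finally show ?thesis by (simp only: h_S complex_cnj_complex_of_real)
  qed
  have int_rh: "integrable M (\<lambda>x. (h x - S x) * cnj (h x))"
    using Bochner_Integration.integrable_diff[OF int_hh int_Sh] by (simp add: algebra_simps)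
  have sq: "complex_of_real ((norm (h x - S x))\<^sup>2)
      = (h x - S x) * cnj (h x) - (h x - S x) * cnj (S x)" for x
    by (simp add: complex_norm_square algebra_simps del: of_real_power)
  have "integrable M (\<lambda>x. (norm (h x - S x))\<^sup>2)"
    using integrable_Re[OF Bochner_Integration.integrable_diff[OF int_rh int_fS[OF int_res]]]
    by (simp only: sq[symmetric] Re_complex_of_real)
  then have "complex_of_real (LINT x|M. (norm (h x - S x))\<^sup>2)
      = (LINT x|M. (h x - S x) * cnj (h x) - (h x - S x) * cnj (S x))"
    by (simp only: sq[symmetric] Bochner_Integration.integral_of_real)
  also have "\<dots> = (LINT x|M. (h x - S x) * cnj (h x))"
    by (subst Bochner_Integration.integral_diff) (use int_rh int_fS[OF int_res] res_S in auto)
  also have "\<dots> = (LINT x|M. h x * cnj (h x) - S x * cnj (h x))"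
    by (simp add: algebra_simps)
  also have "\<dots> = (LINT x|M. h x * cnj (h x)) - (LINT x|M. S x * cnj (h x))"
    by (rule Bochner_Integration.integral_diff[OF int_hh int_Sh])
  also have "(LINT x|M. h x * cnj (h x)) = of_real (LINT x|M. (norm (h x))\<^sup>2)"
    by (simp only: complex_norm_square[symmetric] Bochner_Integration.integral_of_real[OF h2])
  finally have "complex_of_real (LINT x|M. (norm (h x - S x))\<^sup>2)
      = of_real ((LINT x|M. (norm (h x))\<^sup>2) - (\<Sum>i\<in>I. (norm (c i))\<^sup>2) / P)"
    by (simp only: S_h of_real_diff)
  then have "(LINT x|M. (norm (h x - S x))\<^sup>2)
      = (LINT x|M. (norm (h x))\<^sup>2) - (\<Sum>i\<in>I. (norm (c i))\<^sup>2) / P"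
    by (simp only: of_real_eq_iff)
  moreover have "(LINT x|M. (norm (h x - S x))\<^sup>2) \<ge> 0" by simp
  ultimately have "(\<Sum>i\<in>I. (norm (c i))\<^sup>2) / P \<le> (LINT x|M. (norm (h x))\<^sup>2)" by linarith
  then show ?thesis using P by (simp add: c_def field_simps)
qed

lemma exponentials_orthogonal:
  fixes m n :: nat
  assumes R: "R > 0"
  shows "(LINT \<tau>|lebesgue_on {-R..R}. cis (pi * m / R * \<tau>) * cnj (cis (pi * n / R * \<tau>)))
    = (if m = n then of_real (2 * R) else 0)"
proof (cases "m = n")
  case True
  then show ?thesis using R
    by (simp add: cis_cnj cis_mult measure_restrict_space scaleR_conv_of_real)
next
  case False
  define b where "b = pi * (real m - real n) / R"
  have b: "b \<noteq> 0" using False R by (simp add: b_def)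
  have eq: "cis (pi * m / R * \<tau>) * cnj (cis (pi * n / R * \<tau>)) = cis (b * \<tau>)" for \<tau>
    using R by (simp add: cis_cnj cis_mult b_def field_simps)
  have "((\<lambda>\<tau>. cis (b * \<tau>)) has_integral
      cis (b * R) / (\<i> * b) - cis (b * (-R)) / (\<i> * b)) {-R..R}"
  proof (rule fundamental_theorem_of_calculus)
    fix x
    show "((\<lambda>x. cis (b * x) / (\<i> * b)) has_vector_derivative cis (b * x)) (at x within {- R..R})"
      unfolding cis_conv_exp using b
      by (auto intro!: derivative_eq_intros has_vector_derivative_real_field simp: field_simps)
  qed (use R in auto)
  moreover have "cis (b * R) = cis (b * (-R))"
  proof -
    have "cis (b * R) = cis (b * (-R)) * cis (2 * pi * of_int (int m - int n))"
      using R by (simp add: cis_mult b_def field_simps)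
    then show ?thesis by simp
  qed
  ultimately have "((\<lambda>\<tau>. cis (b * \<tau>)) has_integral 0) {-R..R}" by simp
  moreover have "integrable (lebesgue_on {-R..R}) (\<lambda>\<tau>. cis (b * \<tau>))"
    by (intro continuous_imp_integrable_real continuous_intros)
  ultimately have "(LINT \<tau>|lebesgue_on {-R..R}. cis (b * \<tau>)) = 0"
    by (subst lebesgue_integral_eq_integral) (auto dest: integral_unique)
  then show ?thesis unfolding eq using False by simp
qed

text \<open>
  If the transform stayed above \<open>L\<close> in modulus, restricting \<open>h\<close> to an interval whose complement
  carries \<open>L\<^sup>1\<close> norm below \<open>L/2\<close> would leave infinitely many Fourier coefficients above
  \<open>L/2\<close> on that interval, against Bessel's inequality for the square integrable restriction.
\<close>

lemma fourier_not_bounded_below: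
  assumes h: "integrable lebesgue h" and h2: "integrable lebesgue (\<lambda>\<tau>. (norm (h \<tau>))\<^sup>2)"
    and L: "L > 0"
  shows "\<exists>\<xi>\<ge>0. norm (fourier h \<xi>) < L"
proof (rule ccontr)
  assume "\<not> ?thesis"
  then have large: "norm (fourier h \<xi>) \<ge> L" if "\<xi> \<ge> 0" for \<xi>
    using that by force
  let ?tail = "\<lambda>R \<tau>. indicator (- {-R..R}) \<tau> *\<^sub>R h \<tau>"
  have "(\<lambda>n. LINT \<tau>|lebesgue. norm (?tail (real n) \<tau>)) \<longlonglongrightarrow> (LINT \<tau>|(lebesgue :: real measure). (0::real))"
  proof (rule Bochner_Integration.integral_dominated_convergence[where w = "\<lambda>\<tau>. norm (h \<tau>)"])
    show "AE \<tau> in lebesgue. (\<lambda>n. norm (?tail (real n) \<tau>)) \<longlonglongrightarrow> 0"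
    proof (rule AE_I2)
      fix \<tau> :: real
      have "eventually (\<lambda>n. norm (?tail (real n) \<tau>) = 0) sequentially"
        using eventually_ge_at_top[of "nat \<lceil>\<bar>\<tau>\<bar>\<rceil>"]
        by eventually_elim (auto simp: indicator_def)
      then show "(\<lambda>n. norm (?tail (real n) \<tau>)) \<longlonglongrightarrow> 0" by (rule tendsto_eventually)
    qed
    show "(\<lambda>\<tau>. norm (?tail (real n) \<tau>)) \<in> borel_measurable lebesgue" for n
      by (intro borel_measurable_integrable integrable_norm integrable_mult_indicator h) auto
  qed (use h in \<open>auto split: split_indicator\<close>)
  then have "eventually (\<lambda>n. (LINT \<tau>|lebesgue. norm (?tail (real n) \<tau>)) < L / 2) sequentially"
    using L by (intro order_tendstoD) auto
  then have "eventually (\<lambda>n. (LINT \<tau>|lebesgue. norm (?tail (real n) \<tau>)) < L / 2 \<and> n > 0) sequentially"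
    using eventually_gt_at_top[of 0] by eventually_elim simp
  then obtain N where N: "(LINT \<tau>|lebesgue. norm (?tail (real N) \<tau>)) < L / 2" "N > 0"
    by (auto simp: eventually_sequentially)
  define R where "R = real N"
  define J where "J = {-R..R}"
  have R: "R > 0" and tail: "(LINT \<tau>|lebesgue. norm (?tail R \<tau>)) < L / 2"
    using N by (auto simp: R_def)
  (* The n-th exponential of period 2 R pairs with h to sample the transform at n / (2 R). *)
  define e :: "nat \<Rightarrow> real \<Rightarrow> complex" where "e n \<tau> = cis (pi * n / R * \<tau>)" for n \<tau>
  have coeff: "norm (LINT \<tau>|lebesgue_on J. h \<tau> * cnj (e n \<tau>)) \<ge> L / 2" for n
  proof -
    let ?f = "\<lambda>\<tau>. h \<tau> * cnj (e n \<tau>)"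
    have f: "integrable lebesgue ?f"
      unfolding e_def cis_cnj
      by (intro integrable_mult_unimodular h measurable_cis_lebesgue continuous_intros) simp
    have "fourier h (n / (2 * R)) = (LINT \<tau>|lebesgue. indicator J \<tau> *\<^sub>R ?f \<tau> + indicator (- J) \<tau> *\<^sub>R ?f \<tau>)"
      unfolding fourier_def e_def cis_cnj
      by (intro Bochner_Integration.integral_cong) (auto simp: indicator_def field_simps)
    also have "\<dots> = (LINT \<tau>|lebesgue. indicator J \<tau> *\<^sub>R ?f \<tau>) + (LINT \<tau>|lebesgue. indicator (- J) \<tau> *\<^sub>R ?f \<tau>)"
      by (intro Bochner_Integration.integral_add integrable_mult_indicator f) (auto simp: J_def)
    finally have "norm (fourier h (n / (2 * R))) \<le> norm (LINT \<tau>|lebesgue. indicator J \<tau> *\<^sub>R ?f \<tau>)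
        + norm (LINT \<tau>|lebesgue. indicator (- J) \<tau> *\<^sub>R ?f \<tau>)"
      by (metis norm_triangle_ineq)
    moreover have "norm (LINT \<tau>|lebesgue. indicator (- J) \<tau> *\<^sub>R ?f \<tau>) \<le> (LINT \<tau>|lebesgue. norm (?tail R \<tau>))"
      by (rule order.trans[OF integral_norm_bound]) (simp add: norm_mult e_def J_def)
    moreover have "norm (fourier h (n / (2 * R))) \<ge> L" using R by (intro large) auto
    moreover have "(LINT \<tau>|lebesgue. indicator J \<tau> *\<^sub>R ?f \<tau>) = (LINT \<tau>|lebesgue_on J. ?f \<tau>)"
      by (subst integral_restrict_space) (auto simp: J_def)
    ultimately show ?thesis using tail by simp
  qed
  define B where "B = 2 * R * (LINT \<tau>|lebesgue_on J. (norm (h \<tau>))\<^sup>2)"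
  have "real m * (L / 2)\<^sup>2 \<le> B" for m :: nat
  proof -
    have "real m * (L / 2)\<^sup>2 = (\<Sum>n<m. (L / 2)\<^sup>2)" by simp
    also have "\<dots> \<le> (\<Sum>n<m. (norm (LINT \<tau>|lebesgue_on J. h \<tau> * cnj (e n \<tau>)))\<^sup>2)"
      using L by (intro sum_mono power_mono coeff) auto
    also have "\<dots> \<le> B"
      unfolding B_def
    proof (rule bessel_inequality)
      show "finite_measure (lebesgue_on J)" by (rule finite_measure_lebesgue_on) (auto simp: J_def)
      show "integrable (lebesgue_on J) h" "integrable (lebesgue_on J) (\<lambda>\<tau>. (norm (h \<tau>))\<^sup>2)"
        by (subst integrable_restrict_space; (intro integrable_mult_indicator h h2)?; simp add: J_def)+
      show "e n \<in> borel_measurable (lebesgue_on J)" for n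
        unfolding e_def
        by (intro measurable_restrict_space1 measurable_cis_lebesgue continuous_intros)
      show "norm (e n \<tau>) = 1" for n \<tau> by (simp add: e_def)
      show "(LINT \<tau>|lebesgue_on J. e i \<tau> * cnj (e j \<tau>)) = (if i = j then of_real (2 * R) else 0)" for i j
        unfolding e_def J_def using R by (rule exponentials_orthogonal)
    qed (use R in auto)
    finally show ?thesis .
  qed
  moreover obtain m :: nat where "real m * (L / 2)\<^sup>2 > B"
    using reals_Archimedean3[of "(L / 2)\<^sup>2"] L by auto
  ultimately show False by (meson not_less)
qed

lemma fourier_attains:
  assumes h: "integrable lebesgue h" and h2: "integrable lebesgue (\<lambda>\<tau>. (norm (h \<tau>))\<^sup>2)"
    and moment: "integrable lebesgue (\<lambda>\<tau>. \<tau> *\<^sub>R h \<tau>)"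
    and y: "0 < y" "y \<le> norm (fourier h 0)"
  shows "\<exists>\<xi>\<ge>0. norm (fourier h \<xi>) = y"
proof -
  let ?C = "2 * pi * (LINT \<tau>|lebesgue. norm (\<tau> *\<^sub>R h \<tau>))"
  have "?C-lipschitz_on UNIV (fourier h)"
    using fourier_lipschitz[OF h moment] by (intro lipschitz_onI) (auto simp: dist_norm mult_ac)
  then have "continuous_on UNIV (fourier h)" by (rule lipschitz_on_continuous_on)
  then have cont: "continuous_on {0..b} (\<lambda>\<xi>. norm (fourier h \<xi>))" for b
    by (intro continuous_on_norm) (rule continuous_on_subset, auto)
  obtain b where "b \<ge> 0" "norm (fourier h b) < y"
    using fourier_not_bounded_below[OF h h2 y(1)] by blast
  with IVT2'[of "\<lambda>\<xi>. norm (fourier h \<xi>)" b y 0] y cont show ?thesis by auto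
qed

section \<open>The chirped window\<close>

text \<open>
  For fixed \<open>k\<close> and \<open>t\<close>, the function \<open>G\<^sub>k\<close> is the Fourier transform of the window multiplied
  by a unimodular quadratic chirp.  Chirping preserves all absolute moments, so the results on
  Fourier transforms apply uniformly in \<open>k\<close>, \<open>t\<close> and \<open>\<sigma>\<close>.
\<close>

locale chirped_window =
  fixes g :: "real \<Rightarrow> complex" and \<sigma> :: "real \<Rightarrow> real" and \<phi> :: "nat \<Rightarrow> real \<Rightarrow> real"
  assumes window: "admissible_window g" and moment1: "finite_abs_moment g 1"
begin

lemma integrable_g: "integrable lebesgue g"
  using window by (simp add: admissible_window_def)

definition chirp :: "nat \<Rightarrow> real \<Rightarrow> real \<Rightarrow> complex"
  where "chirp k t \<tau> = g \<tau> * cis (pi * (\<sigma> t)\<^sup>2 * (deriv ^^ 2) (\<phi> k) t * \<tau>\<^sup>2)"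

lemma G_eq_fourier: "G g \<sigma> \<phi> k t = fourier (chirp k t)"
  by (simp add: G_def fourier_def chirp_def fun_eq_iff mult_ac)

lemma norm_chirp: "norm (chirp k t \<tau>) = norm (g \<tau>)"
  by (simp add: chirp_def norm_mult)

lemma integrable_chirp: "integrable lebesgue (chirp k t)"
  unfolding chirp_def
  by (intro integrable_mult_unimodular integrable_g measurable_cis_lebesgue continuous_intros) simp

lemma integrable_chirp_squared: "integrable lebesgue (\<lambda>\<tau>. (norm (chirp k t \<tau>))\<^sup>2)"
  using window by (simp add: admissible_window_def norm_chirp)

lemma integrable_chirp_moment: "integrable lebesgue (\<lambda>\<tau>. \<tau> *\<^sub>R chirp k t \<tau>)"
proof (rule Bochner_Integration.integrable_bound)
  show "integrable lebesgue (\<lambda>\<tau>. norm (of_real (\<tau> ^ 1) * g \<tau>))"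
    using moment1 by (simp only: finite_abs_moment_def)
  show "(\<lambda>\<tau>. \<tau> *\<^sub>R chirp k t \<tau>) \<in> borel_measurable lebesgue"
    by (intro borel_measurable_scaleR borel_measurable_integrable[OF integrable_chirp]
        measurable_completion) simp
qed (simp add: norm_chirp norm_mult)

lemma G_lipschitz:
  "norm (G g \<sigma> \<phi> k t a - G g \<sigma> \<phi> k t b) \<le> 2 * pi * \<bar>a - b\<bar> * abs_moment g 1"
  using fourier_lipschitz[OF integrable_chirp integrable_chirp_moment, of k t a b]
  by (simp add: G_eq_fourier abs_moment_def norm_chirp norm_mult)

lemma abs_G_window:
  "norm (G g \<sigma> \<phi> k t (- \<xi>)) = norm (G g \<sigma> \<phi> k t \<xi>)"
  "strict_antimono_on {0..} (\<lambda>\<xi>. norm (G g \<sigma> \<phi> k t \<xi>))"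
proof -
  (* Admissibility is phrased with the phase - pi c tau^2, hence the sign of c. *)
  define c where "c = - ((\<sigma> t)\<^sup>2 * (deriv ^^ 2) (\<phi> k) t)"
  have "G g \<sigma> \<phi> k t \<xi> = (LINT \<tau>|lebesgue. g \<tau> * cis (- 2 * pi * \<xi> * \<tau> - pi * c * \<tau>\<^sup>2))" for \<xi>
    unfolding G_def
    by (rule Bochner_Integration.integral_cong)
       (simp_all add: c_def cis_mult algebra_simps flip: mult.assoc[of "cis _"])
  then show "norm (G g \<sigma> \<phi> k t (- \<xi>)) = norm (G g \<sigma> \<phi> k t \<xi>)"
    "strict_antimono_on {0..} (\<lambda>\<xi>. norm (G g \<sigma> \<phi> k t \<xi>))"
    using window unfolding admissible_window_def Let_def by auto
qed

text \<open>
  Evenness and strict monotonicity together: comparing values of \<open>\<bar>G\<^sub>k\<bar>\<close> is the same as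
  comparing distances from the origin in reverse.
\<close>

lemma abs_G_less_iff:
  "norm (G g \<sigma> \<phi> k t b) < norm (G g \<sigma> \<phi> k t a) \<longleftrightarrow> \<bar>a\<bar> < \<bar>b\<bar>"
proof -
  have abs: "norm (G g \<sigma> \<phi> k t \<xi>) = norm (G g \<sigma> \<phi> k t \<bar>\<xi>\<bar>)" for \<xi>
    using abs_G_window(1)[of k t \<xi>] by (cases "\<xi> \<ge> 0") auto
  have less: "norm (G g \<sigma> \<phi> k t v) < norm (G g \<sigma> \<phi> k t u)" if "0 \<le> u" "u < v" for u v
    using abs_G_window(2)[of k t] that by (auto simp: monotone_on_def)
  show ?thesis
    unfolding abs[of a] abs[of b] using less[of "\<bar>a\<bar>" "\<bar>b\<bar>"] less[of "\<bar>b\<bar>" "\<bar>a\<bar>"]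
    by (cases "\<bar>a\<bar>" "\<bar>b\<bar>" rule: linorder_cases) auto
qed

lemma abs_G_le_iff:
  "norm (G g \<sigma> \<phi> k t b) \<le> norm (G g \<sigma> \<phi> k t a) \<longleftrightarrow> \<bar>a\<bar> \<le> \<bar>b\<bar>"
  using abs_G_less_iff[of k t a b] by (simp flip: not_less)

lemma abs_G_attains:
  assumes "0 < y" "y \<le> norm (G g \<sigma> \<phi> k t 0)"
  shows "\<exists>\<xi>\<ge>0. norm (G g \<sigma> \<phi> k t \<xi>) = y"
  using assms fourier_attains[OF integrable_chirp integrable_chirp_squared integrable_chirp_moment]
  by (simp add: G_eq_fourier)

text \<open>
  Positive values up to the peak are attained, and only at attained values does
  \<^const>\<open>the_inv_into\<close> invert \<open>\<bar>G\<^sub>k\<bar>\<close>; elsewhere it is arbitrary.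
\<close>

lemma abs_G_inv:
  assumes "0 < y" "y \<le> norm (G g \<sigma> \<phi> k t 0)"
  shows "abs_G_inv g \<sigma> \<phi> k t y \<ge> 0" "norm (G g \<sigma> \<phi> k t (abs_G_inv g \<sigma> \<phi> k t y)) = y"
proof -
  let ?F = "\<lambda>\<xi>. norm (G g \<sigma> \<phi> k t \<xi>)"
  have inj: "inj_on ?F {0..}"
  proof (rule inj_onI)
    fix a b :: real assume "a \<in> {0..}" "b \<in> {0..}" "?F a = ?F b"
    then show "a = b" using abs_G_le_iff[of k t a b] abs_G_le_iff[of k t b a] by auto
  qed
  have y: "y \<in> ?F ` {0..}" using abs_G_attains[OF assms] by auto
  show "abs_G_inv g \<sigma> \<phi> k t y \<ge> 0"
    using the_inv_into_into[OF inj y] by (auto simp: abs_G_inv_def)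
  show "?F (abs_G_inv g \<sigma> \<phi> k t y) = y"
    unfolding abs_G_inv_def by (rule f_the_inv_into_f[OF inj y])
qed

lemma essential_radius:
  assumes "0 < \<tau>\<^sub>0" "\<tau>\<^sub>0 < norm (G g \<sigma> \<phi> k t 0)"
  shows "essential_radius g \<sigma> \<phi> \<tau>\<^sub>0 k t > 0"
    "norm (G g \<sigma> \<phi> k t (essential_radius g \<sigma> \<phi> \<tau>\<^sub>0 k t)) = \<tau>\<^sub>0"
proof -
  have "\<exists>!\<xi>. \<xi> > 0 \<and> norm (G g \<sigma> \<phi> k t \<xi>) = \<tau>\<^sub>0"
  proof (rule ex_ex1I)
    obtain \<xi> where "\<xi> \<ge> 0" "norm (G g \<sigma> \<phi> k t \<xi>) = \<tau>\<^sub>0"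
      using abs_G_attains[of \<tau>\<^sub>0 k t] assms by auto
    moreover from this have "\<xi> \<noteq> 0" using assms by auto
    ultimately show "\<exists>\<xi>. \<xi> > 0 \<and> norm (G g \<sigma> \<phi> k t \<xi>) = \<tau>\<^sub>0" by (auto simp: less_le)
  next
    fix a b assume "a > 0 \<and> norm (G g \<sigma> \<phi> k t a) = \<tau>\<^sub>0" "b > 0 \<and> norm (G g \<sigma> \<phi> k t b) = \<tau>\<^sub>0"
    then show "a = b" using abs_G_le_iff[of k t a b] abs_G_le_iff[of k t b a] by auto
  qed
  from theI'[OF this] show "essential_radius g \<sigma> \<phi> \<tau>\<^sub>0 k t > 0"
    "norm (G g \<sigma> \<phi> k t (essential_radius g \<sigma> \<phi> \<tau>\<^sub>0 k t)) = \<tau>\<^sub>0"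
    by (auto simp: essential_radius_def)
qed

end

section \<open>Local chirp approximation\<close>

lemma C_n_has_deriv:
  assumes "C_n n f" "m < n"
  shows "((deriv ^^ m) f has_real_derivative (deriv ^^ Suc m) f t) (at t)"
proof -
  have "(deriv ^^ m) f differentiable_on UNIV" using assms by (simp add: C_n_def)
  then have "(deriv ^^ m) f field_differentiable at t"
    by (simp add: differentiable_on_def field_differentiable_def real_differentiable_def)
  then show ?thesis by (simp add: DERIV_deriv_iff_field_differentiable)
qed

lemma phase_taylor:
  assumes f: "C_n 3 f" and bound: "\<And>t. \<bar>(deriv ^^ 3) f t\<bar> \<le> e"
  shows "\<bar>f (t + h) - (f t + deriv f t * h + (deriv ^^ 2) f t * h\<^sup>2 / 2)\<bar> \<le> e * \<bar>h\<bar> ^ 3 / 6"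
proof (cases "h = 0")
  case False
  obtain u where u: "f (t + h) = (\<Sum>m<3. (deriv ^^ m) f t / fact m * (t + h - t) ^ m)
      + (deriv ^^ 3) f u / fact 3 * (t + h - t) ^ 3"
    using Taylor[of 3 "\<lambda>m. (deriv ^^ m) f" f "min t (t + h)" "max t (t + h)" t "t + h"]
      C_n_has_deriv[OF f] False by auto
  have rem: "f (t + h) - (f t + deriv f t * h + (deriv ^^ 2) f t * h\<^sup>2 / 2) = (deriv ^^ 3) f u * h ^ 3 / 6"
    using u by (simp add: eval_nat_numeral lessThan_Suc)
  show ?thesis
    unfolding rem using bound[of u] by (simp add: abs_mult power_abs mult_right_mono)
qed simp

lemma continuous_on_amplitude:
  fixes a :: "real \<Rightarrow> real"
  assumes "\<And>t \<tau>. \<bar>a (t + \<tau>) - a t\<bar> \<le> e * \<bar>\<tau>\<bar> * a t"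
  shows "continuous_on UNIV a"
proof (rule continuous_at_imp_continuous_on, rule ballI)
  fix t :: real
  have "((\<lambda>\<tau>. e * \<bar>\<tau>\<bar> * a t) \<longlongrightarrow> e * \<bar>0\<bar> * a t) (at 0)" by (intro tendsto_intros)
  then have lim: "((\<lambda>\<tau>. e * \<bar>\<tau>\<bar> * a t) \<longlongrightarrow> 0) (at 0)" by simp
  have "((\<lambda>\<tau>. a (t + \<tau>) - a t) \<longlongrightarrow> 0) (at 0)"
    by (rule Lim_null_comparison[OF _ lim]) (simp only: real_norm_def assms eventually_True)
  then have "((\<lambda>\<tau>. a (t + \<tau>)) \<longlongrightarrow> a t) (at 0)" by (simp add: LIM_zero_iff)
  then show "isCont a t" by (simp add: isCont_iff)
qed

lemma deriv_funpow_zero: "(deriv ^^ n) (\<lambda>_. 0 :: real) = (\<lambda>_. 0)"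
  by (induction n) auto

locale slowly_varying_signal =
  fixes \<epsilon>\<^sub>1 \<epsilon>\<^sub>3 :: real and K :: nat and A \<phi> :: "nat \<Rightarrow> real \<Rightarrow> real"
  assumes eps_pos: "\<epsilon>\<^sub>1 > 0" "\<epsilon>\<^sub>3 > 0" and x_class: "signal_class \<epsilon>\<^sub>1 \<epsilon>\<^sub>3 K A \<phi>"
begin

lemma trend_phase: "\<phi> 0 = (\<lambda>_. 0)"
  using x_class by (simp add: signal_class_def)

lemma amplitude_pos: "k \<le> K \<Longrightarrow> A k t > 0"
  using x_class by (simp add: signal_class_def)

lemma amplitude_variation: "k \<le> K \<Longrightarrow> \<bar>A k (t + \<tau>) - A k t\<bar> \<le> \<epsilon>\<^sub>1 * \<bar>\<tau>\<bar> * A k t"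
  using x_class by (simp add: signal_class_def)

text \<open>
  The derivatives of the zero phase vanish, so the trend obeys the same regularity bounds as the
  oscillating components and can be approximated along with them.
\<close>

lemma phase_smooth:
  assumes "k \<le> K"
  shows "C_n 3 (\<phi> k)" "\<bar>(deriv ^^ 3) (\<phi> k) t\<bar> \<le> \<epsilon>\<^sub>3"
  using assms x_class eps_pos trend_phase
  by (cases "k = 0"; auto simp: signal_class_def C_n_def deriv_funpow_zero)+

lemma frequency_strict_mono:
  assumes "k < l" "l \<le> K"
  shows "deriv (\<phi> k) t < deriv (\<phi> l) t"
proof -
  have pos: "f t > 0" if "(INF t. ereal (f t)) > 0" for f :: "real \<Rightarrow> real"
    using less_INF_D[OF that, of t] by simp
  have step: "deriv (\<phi> j) t < deriv (\<phi> (Suc j)) t" if "Suc j \<le> K" for j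
  proof (cases "j = 0")
    case True
    have "(INF t. ereal (deriv (\<phi> 1) t)) > 0"
      using x_class that True by (auto simp: signal_class_def)
    then show ?thesis using pos[of "deriv (\<phi> 1)"] True trend_phase by simp
  next
    case False
    then have "Suc j \<in> {2..K}" using that by auto
    moreover have "\<forall>k\<in>{2..K}. (INF t. ereal (deriv (\<phi> k) t - deriv (\<phi> (k - 1)) t)) > 0"
      using x_class unfolding signal_class_def by (elim conjE)
    ultimately have "(INF t. ereal (deriv (\<phi> (Suc j)) t - deriv (\<phi> (Suc j - 1)) t)) > 0"
      by (rule bspec[rotated])
    then show ?thesis using pos[of "\<lambda>t. deriv (\<phi> (Suc j)) t - deriv (\<phi> j) t"] by simp
  qed
  from assms show ?thesis
  proof (induction l)
    case (Suc l)
    then show ?case using step[of l] by (cases "k = l") auto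
  qed simp
qed

lemma continuous_on_component:
  assumes "k \<le> K"
  shows "continuous_on UNIV (component A \<phi> k)"
proof -
  have "continuous_on UNIV (A k)"
    using amplitude_variation[OF assms] by (rule continuous_on_amplitude)
  moreover have "continuous_on UNIV (\<phi> k)"
    using phase_smooth(1)[OF assms] unfolding C_n_def
    by (metis differentiable_imp_continuous_on funpow_0 zero_less_numeral)
  ultimately show ?thesis
    unfolding component_def[abs_def] by (intro continuous_intros)
qed

lemma signal_eq_sum: "signal K A \<phi> t = (\<Sum>k=0..K. component A \<phi> k t)"
  by (simp add: signal_def sum.atLeast_Suc_atMost component_def trend_phase)

text \<open>
  Change the amplitude first, at cost \<open>\<epsilon>\<^sub>1 \<bar>h\<bar> A\<^sub>k\<close>, then the phase, at cost \<open>2\<pi>A\<^sub>k\<close>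
  times the cubic Taylor remainder \<open>\<epsilon>\<^sub>3 \<bar>h\<bar>\<^sup>3 / 6\<close>.
\<close>

lemma component_local_chirp:
  assumes k: "k \<le> K"
  shows "norm (component A \<phi> k (t + h)
      - component A \<phi> k t * cis (2 * pi * (deriv (\<phi> k) t * h + (deriv ^^ 2) (\<phi> k) t * h\<^sup>2 / 2)))
    \<le> A k t * (\<epsilon>\<^sub>1 * \<bar>h\<bar> + pi / 3 * \<epsilon>\<^sub>3 * \<bar>h\<bar> ^ 3)"
proof -
  define p where "p = \<phi> k t + deriv (\<phi> k) t * h + (deriv ^^ 2) (\<phi> k) t * h\<^sup>2 / 2"
  have A: "A k t > 0" by (rule amplitude_pos[OF k])
  have phase: "\<bar>\<phi> k (t + h) - p\<bar> \<le> \<epsilon>\<^sub>3 * \<bar>h\<bar> ^ 3 / 6"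
    unfolding p_def using phase_smooth[OF k] by (intro phase_taylor)
  have chirp: "component A \<phi> k t * cis (2 * pi * (deriv (\<phi> k) t * h + (deriv ^^ 2) (\<phi> k) t * h\<^sup>2 / 2))
      = of_real (A k t) * cis (2 * pi * p)"
    by (simp add: component_def cis_mult p_def algebra_simps)
  have split: "component A \<phi> k (t + h)
      - component A \<phi> k t * cis (2 * pi * (deriv (\<phi> k) t * h + (deriv ^^ 2) (\<phi> k) t * h\<^sup>2 / 2))
    = of_real (A k (t + h) - A k t) * cis (2 * pi * \<phi> k (t + h))
      + of_real (A k t) * (cis (2 * pi * \<phi> k (t + h)) - cis (2 * pi * p))"
    unfolding chirp component_def[of A \<phi> k "t + h"] by (simp add: algebra_simps)
  have "norm (component A \<phi> k (t + h)
      - component A \<phi> k t * cis (2 * pi * (deriv (\<phi> k) t * h + (deriv ^^ 2) (\<phi> k) t * h\<^sup>2 / 2)))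
    \<le> \<bar>A k (t + h) - A k t\<bar> + A k t * norm (cis (2 * pi * \<phi> k (t + h)) - cis (2 * pi * p))"
    unfolding split using A
    by (intro order.trans[OF norm_triangle_ineq]) (simp add: norm_mult del: of_real_diff)
  also have "\<dots> \<le> \<epsilon>\<^sub>1 * \<bar>h\<bar> * A k t + A k t * \<bar>2 * pi * \<phi> k (t + h) - 2 * pi * p\<bar>"
    using A by (intro add_mono amplitude_variation[OF k] mult_left_mono norm_cis_diff_le) auto
  also have "\<bar>2 * pi * \<phi> k (t + h) - 2 * pi * p\<bar> = 2 * pi * \<bar>\<phi> k (t + h) - p\<bar>"
    by (simp add: abs_mult flip: right_diff_distrib)
  also have "\<epsilon>\<^sub>1 * \<bar>h\<bar> * A k t + A k t * (2 * pi * \<bar>\<phi> k (t + h) - p\<bar>)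
      \<le> \<epsilon>\<^sub>1 * \<bar>h\<bar> * A k t + A k t * (2 * pi * (\<epsilon>\<^sub>3 * \<bar>h\<bar> ^ 3 / 6))"
    using A phase by (intro add_left_mono mult_left_mono) auto
  also have "\<dots> = A k t * (\<epsilon>\<^sub>1 * \<bar>h\<bar> + pi / 3 * \<epsilon>\<^sub>3 * \<bar>h\<bar> ^ 3)"
    by (simp add: algebra_simps)
  finally show ?thesis .
qed

end

section \<open>Approximation of the adaptive transform\<close>

locale stft_setting = slowly_varying_signal \<epsilon>\<^sub>1 \<epsilon>\<^sub>3 K A \<phi> + chirped_window g \<sigma> \<phi>
  for \<epsilon>\<^sub>1 \<epsilon>\<^sub>3 K A \<phi> g \<sigma> +
  assumes moment3: "finite_abs_moment g 3" and sigma_pos: "\<And>t. \<sigma> t > 0"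
begin

lemma integrable_moments:
  "integrable lebesgue (\<lambda>\<tau>. \<bar>\<tau>\<bar> * norm (g \<tau>))" "integrable lebesgue (\<lambda>\<tau>. \<bar>\<tau>\<bar> ^ 3 * norm (g \<tau>))"
  using moment1 moment3 by (simp_all add: finite_abs_moment_def norm_mult norm_power)

lemma abs_moment_eq: "abs_moment g n = (LINT \<tau>|lebesgue. \<bar>\<tau>\<bar> ^ n * norm (g \<tau>))"
  by (simp add: abs_moment_def norm_mult norm_power)

text \<open>
  Replacing the component by its local chirp turns the rescaled integral into a value of
  \<open>G\<^sub>k\<close>; the two cost terms of the replacement, integrated against \<open>\<bar>g\<bar>\<close>, produce the
  moments \<open>I\<^sub>1\<close> and \<open>I\<^sub>3\<close> in \<open>\<Pi>\<^sub>0\<close>.  Integrability is part of the claim: the local chirp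
  is integrable against \<open>g\<close>, and the error is dominated by these moments.
\<close>

lemma component_stft:
  assumes k: "k \<le> K"
  shows "integrable lebesgue
      (\<lambda>\<tau>. component A \<phi> k (t + \<sigma> t * \<tau>) * (g \<tau> * cis (- 2 * pi * \<eta> * (\<sigma> t * \<tau>))))"
      (is "integrable _ ?f")
    and "norm ((LINT \<tau>|lebesgue. component A \<phi> k (t + \<sigma> t * \<tau>) * (g \<tau> * cis (- 2 * pi * \<eta> * (\<sigma> t * \<tau>))))
        - component A \<phi> k t * G g \<sigma> \<phi> k t (\<sigma> t * (\<eta> - deriv (\<phi> k) t)))
      \<le> A k t * Pi0 g \<sigma> \<epsilon>\<^sub>1 \<epsilon>\<^sub>3 t"
proof -
  define s where "s = \<sigma> t"
  define w where "w = deriv (\<phi> k) t"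
  define d where "d = (deriv ^^ 2) (\<phi> k) t"
  have s: "s > 0" using sigma_pos by (simp add: s_def)
  (* u is the modulated window, m the integrand of the local chirp, b the pointwise bound on the
     difference between the integrand of the component and m. *)
  define u where "u \<tau> = g \<tau> * cis (- 2 * pi * \<eta> * (s * \<tau>))" for \<tau>
  define m where "m \<tau> = component A \<phi> k t * cis (2 * pi * (w * (s * \<tau>) + d * (s * \<tau>)\<^sup>2 / 2)) * u \<tau>" for \<tau>
  define b where "b \<tau> = A k t * (\<epsilon>\<^sub>1 * s * (\<bar>\<tau>\<bar> * norm (g \<tau>)) + pi / 3 * \<epsilon>\<^sub>3 * s ^ 3 * (\<bar>\<tau>\<bar> ^ 3 * norm (g \<tau>)))" for \<tau>
  have f: "?f = (\<lambda>\<tau>. component A \<phi> k (t + s * \<tau>) * u \<tau>)"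
    by (simp add: u_def s_def)
  have int_u: "integrable lebesgue u"
    unfolding u_def
    by (intro integrable_mult_unimodular integrable_g measurable_cis_lebesgue continuous_intros) simp
  have int_b: "integrable lebesgue b"
    unfolding b_def
    by (intro integrable_mult_right Bochner_Integration.integrable_add integrable_moments)
  have m_eq: "m \<tau> = component A \<phi> k t * (cis (pi * s\<^sup>2 * d * \<tau>\<^sup>2) * g \<tau> * cis (- 2 * pi * (s * (\<eta> - w)) * \<tau>))" for \<tau>
  proof -
    have "cis (2 * pi * (w * (s * \<tau>) + d * (s * \<tau>)\<^sup>2 / 2)) * cis (- 2 * pi * \<eta> * (s * \<tau>))
        = cis (pi * s\<^sup>2 * d * \<tau>\<^sup>2) * cis (- 2 * pi * (s * (\<eta> - w)) * \<tau>)"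
      unfolding cis_mult by (rule arg_cong[where f = cis]) (simp add: algebra_simps power2_eq_square)
    then show ?thesis by (simp only: m_def u_def mult.assoc mult.left_commute[of "cis _" "g _"])
  qed
  have int_m: "integrable lebesgue m"
  proof -
    have "integrable lebesgue (\<lambda>\<tau>. component A \<phi> k t *
        (u \<tau> * cis (2 * pi * (w * (s * \<tau>) + d * (s * \<tau>)\<^sup>2 / 2))))"
      by (intro integrable_mult_right integrable_mult_unimodular[OF int_u] measurable_cis_lebesgue
          continuous_intros) simp_all
    then show ?thesis unfolding m_def by (simp add: mult_ac)
  qed
  have close: "norm (component A \<phi> k (t + s * \<tau>) * u \<tau> - m \<tau>) \<le> b \<tau>" for \<tau>
  proof -
    have "norm (component A \<phi> k (t + s * \<tau>) * u \<tau> - m \<tau>) = norm (component A \<phi> k (t + s * \<tau>)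
        - component A \<phi> k t * cis (2 * pi * (w * (s * \<tau>) + d * (s * \<tau>)\<^sup>2 / 2))) * norm (g \<tau>)"
      by (simp only: m_def u_def norm_mult norm_cis mult_1_right flip: left_diff_distrib)
    also have "\<dots> \<le> A k t * (\<epsilon>\<^sub>1 * \<bar>s * \<tau>\<bar> + pi / 3 * \<epsilon>\<^sub>3 * \<bar>s * \<tau>\<bar> ^ 3) * norm (g \<tau>)"
      unfolding w_def d_def by (intro mult_right_mono component_local_chirp k) simp
    also have "\<dots> = b \<tau>"
      using s by (simp add: b_def abs_mult power_mult_distrib algebra_simps)
    finally show ?thesis .
  qed
  have meas: "(\<lambda>\<tau>. component A \<phi> k (t + s * \<tau>)) \<in> borel_measurable lebesgue"
  proof -
    have "continuous_on UNIV (\<lambda>\<tau>. component A \<phi> k (t + s * \<tau>))"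
      by (rule continuous_on_compose2[OF continuous_on_component[OF k]]) (auto intro: continuous_intros)
    from borel_measurable_continuous_onI[OF this] show ?thesis by (simp add: measurable_completion)
  qed
  have int_diff: "integrable lebesgue (\<lambda>\<tau>. component A \<phi> k (t + s * \<tau>) * u \<tau> - m \<tau>)"
  proof (rule Bochner_Integration.integrable_bound[OF int_b])
    show "(\<lambda>\<tau>. component A \<phi> k (t + s * \<tau>) * u \<tau> - m \<tau>) \<in> borel_measurable lebesgue"
      by (intro borel_measurable_diff borel_measurable_times meas borel_measurable_integrable int_u int_m)
    show "AE \<tau> in lebesgue. norm (component A \<phi> k (t + s * \<tau>) * u \<tau> - m \<tau>) \<le> norm (b \<tau>)"
      by (rule AE_I2) (rule order_trans[OF close], simp)
  qed
  show int_f: "integrable lebesgue ?f"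
    unfolding f using Bochner_Integration.integrable_add[OF int_diff int_m] by simp
  have "(LINT \<tau>|lebesgue. m \<tau>) = component A \<phi> k t * G g \<sigma> \<phi> k t (\<sigma> t * (\<eta> - deriv (\<phi> k) t))"
    unfolding m_eq G_def s_def w_def d_def by (rule integral_mult_right_zero)
  then have "norm ((LINT \<tau>|lebesgue. ?f \<tau>) - component A \<phi> k t * G g \<sigma> \<phi> k t (\<sigma> t * (\<eta> - deriv (\<phi> k) t)))
      = norm (LINT \<tau>|lebesgue. ?f \<tau> - m \<tau>)"
    by (subst Bochner_Integration.integral_diff[OF int_f int_m]) simp
  also have "\<dots> \<le> (LINT \<tau>|lebesgue. b \<tau>)"
    using Bochner_Integration.integral_norm_bound_integral[OF int_diff int_b close]
    by (simp only: u_def s_def)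
  also have "\<dots> = A k t * Pi0 g \<sigma> \<epsilon>\<^sub>1 \<epsilon>\<^sub>3 t"
  proof -
    have "(LINT \<tau>|lebesgue. b \<tau>) = A k t * ((LINT \<tau>|lebesgue. \<epsilon>\<^sub>1 * s * (\<bar>\<tau>\<bar> * norm (g \<tau>)))
        + (LINT \<tau>|lebesgue. pi / 3 * \<epsilon>\<^sub>3 * s ^ 3 * (\<bar>\<tau>\<bar> ^ 3 * norm (g \<tau>))))"
      unfolding b_def integral_mult_right_zero[of _ "A k t"]
      by (subst Bochner_Integration.integral_add) (intro integrable_mult_right integrable_moments refl)+
    then show ?thesis
      by (simp only: integral_mult_right_zero Pi0_def abs_moment_eq s_def power_one_right)
        (simp only: mult_ac)
  qed
  finally show "norm ((LINT \<tau>|lebesgue. ?f \<tau>) - component A \<phi> k t * G g \<sigma> \<phi> k t (\<sigma> t * (\<eta> - deriv (\<phi> k) t)))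
      \<le> A k t * Pi0 g \<sigma> \<epsilon>\<^sub>1 \<epsilon>\<^sub>3 t" .
qed

lemma adaptive_stft_rescaled:
  "adaptive_stft g \<sigma> x t \<eta> =
    (LINT \<tau>|lebesgue. x (t + \<sigma> t * \<tau>) * (g \<tau> * cis (- 2 * pi * \<eta> * (\<sigma> t * \<tau>))))"
proof -
  have s: "\<sigma> t > 0" by (rule sigma_pos)
  have "adaptive_stft g \<sigma> x t \<eta> = \<bar>\<sigma> t\<bar> *\<^sub>R (LINT \<tau>|lebesgue. x (t + (0 + \<sigma> t * \<tau>)) * of_real (1 / \<sigma> t)
      * g ((0 + \<sigma> t * \<tau>) / \<sigma> t) * cis (- 2 * pi * \<eta> * (0 + \<sigma> t * \<tau>)))"
    unfolding adaptive_stft_def by (rule lebesgue_integral_real_affine) (use s in auto)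
  also have "\<dots> = (LINT \<tau>|lebesgue. \<bar>\<sigma> t\<bar> *\<^sub>R (x (t + (0 + \<sigma> t * \<tau>)) * of_real (1 / \<sigma> t)
      * g ((0 + \<sigma> t * \<tau>) / \<sigma> t) * cis (- 2 * pi * \<eta> * (0 + \<sigma> t * \<tau>))))"
    by (rule integral_scaleR_right[symmetric])
  also have "\<dots> = (LINT \<tau>|lebesgue. x (t + \<sigma> t * \<tau>) * (g \<tau> * cis (- 2 * pi * \<eta> * (\<sigma> t * \<tau>))))"
    using s by (intro Bochner_Integration.integral_cong) (auto simp: scaleR_conv_of_real field_simps)
  finally show ?thesis .
qed

lemma stft_approx:
  "norm (adaptive_stft g \<sigma> (signal K A \<phi>) t \<eta>
      - (\<Sum>k=0..K. component A \<phi> k t * G g \<sigma> \<phi> k t (\<sigma> t * (\<eta> - deriv (\<phi> k) t))))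
    \<le> sum_amp K A t * Pi0 g \<sigma> \<epsilon>\<^sub>1 \<epsilon>\<^sub>3 t"
proof -
  let ?I = "\<lambda>k. LINT \<tau>|lebesgue. component A \<phi> k (t + \<sigma> t * \<tau>) * (g \<tau> * cis (- 2 * pi * \<eta> * (\<sigma> t * \<tau>)))"
  let ?G = "\<lambda>k. component A \<phi> k t * G g \<sigma> \<phi> k t (\<sigma> t * (\<eta> - deriv (\<phi> k) t))"
  have "adaptive_stft g \<sigma> (signal K A \<phi>) t \<eta> = (\<Sum>k=0..K. ?I k)"
    unfolding adaptive_stft_rescaled signal_eq_sum sum_distrib_right
    by (rule Bochner_Integration.integral_sum) (rule component_stft(1), simp)
  then have "norm (adaptive_stft g \<sigma> (signal K A \<phi>) t \<eta> - (\<Sum>k=0..K. ?G k))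
      = norm (\<Sum>k=0..K. ?I k - ?G k)"
    by (simp add: sum_subtractf)
  also have "\<dots> \<le> (\<Sum>k=0..K. A k t * Pi0 g \<sigma> \<epsilon>\<^sub>1 \<epsilon>\<^sub>3 t)"
    by (intro sum_norm_le component_stft(2)) simp
  finally show ?thesis by (simp add: sum_amp_def sum_distrib_right)
qed

end

section \<open>Separation of the zones\<close>

lemma disjoint_balls_separated:
  fixes a b r q :: real
  assumes "a < b" "r > 0" "q > 0" and disj: "\<And>\<eta>. \<bar>\<eta> - a\<bar> < r \<Longrightarrow> \<not> \<bar>\<eta> - b\<bar> < q"
  shows "a + r \<le> b - q"
proof (rule ccontr)
  assume "\<not> ?thesis"
  then have "max (a - r) (b - q) < min (a + r) (b + q)" using assms(1-3) by auto
  then obtain \<eta> where "max (a - r) (b - q) < \<eta>" "\<eta> < min (a + r) (b + q)" using dense by blast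
  then show False using disj[of \<eta>] by (auto simp: abs_less_iff)
qed

text \<open>
  The balls strictly between the \<open>k\<close>-th and the \<open>l\<close>-th lie side by side in the gap, each
  taking up its full diameter, which explains the factor 2 in \<^const>\<open>Upsilon\<close>.
\<close>

lemma separated_balls_distance:
  fixes w r :: "nat \<Rightarrow> real"
  assumes sep: "\<And>k l. k < l \<Longrightarrow> l \<le> K \<Longrightarrow> w k + r k \<le> w l - r l"
    and "k < l" "l \<le> K"
  shows "r k + r l + 2 * (\<Sum>j\<in>{k<..<l}. r j) \<le> w l - w k"
  using \<open>k < l\<close> \<open>l \<le> K\<close>
proof (induction l)
  case (Suc l)
  have step: "r l + r (Suc l) \<le> w (Suc l) - w l" using sep[of l "Suc l"] Suc.prems by simp
  show ?case
  proof (cases "k = l")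
    case True
    then have "{k<..<Suc l} = {}" by auto
    then show ?thesis using step True by simp
  next
    case False
    then have "k < l" using Suc.prems by simp
    then have "{k<..<Suc l} = insert l {k<..<l}" by auto
    then have "(\<Sum>j\<in>{k<..<Suc l}. r j) = r l + (\<Sum>j\<in>{k<..<l}. r j)" by simp
    then show ?thesis using step Suc.IH \<open>k < l\<close> Suc.prems by simp
  qed
qed simp

section \<open>Ridges\<close>

locale ridge_setting = stft_setting \<epsilon>\<^sub>1 \<epsilon>\<^sub>3 K A \<phi> g \<sigma>
  for \<epsilon>\<^sub>1 \<epsilon>\<^sub>3 K A \<phi> g \<sigma> +
  fixes \<tau>\<^sub>0 :: real and \<alpha> :: "nat \<Rightarrow> real \<Rightarrow> real"
  assumes tau0_pos: "0 < \<tau>\<^sub>0"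
    and alpha_ge: "\<And>k t. k \<le> K \<Longrightarrow> \<alpha> k t \<ge> essential_radius g \<sigma> \<phi> \<tau>\<^sub>0 k t"
    and zones_disjoint: "\<And>k l. k \<le> K \<Longrightarrow> l \<le> K \<Longrightarrow> k \<noteq> l \<Longrightarrow> zone \<sigma> \<phi> \<alpha> k \<inter> zone \<sigma> \<phi> \<alpha> l = {}"
    and small: "\<And>t. 2 * sum_amp K A t * (\<tau>\<^sub>0 + Pi0 g \<sigma> \<epsilon>\<^sub>1 \<epsilon>\<^sub>3 t) \<le> min_G0 g \<sigma> K \<phi> t * min_amp K A t"
begin

abbreviation V :: "real \<Rightarrow> real \<Rightarrow> complex"
  where "V \<equiv> adaptive_stft g \<sigma> (signal K A \<phi>)"

abbreviation offset :: "nat \<Rightarrow> real \<Rightarrow> real \<Rightarrow> real"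
  where "offset k t \<eta> \<equiv> \<sigma> t * (\<eta> - deriv (\<phi> k) t)"

lemma norm_component: "k \<le> K \<Longrightarrow> norm (component A \<phi> k t) = A k t"
  using amplitude_pos[of k t] by (simp add: component_def norm_mult)

lemma Pi0_nonneg: "Pi0 g \<sigma> \<epsilon>\<^sub>1 \<epsilon>\<^sub>3 t \<ge> 0"
  using eps_pos sigma_pos[of t] unfolding Pi0_def abs_moment_def by simp

lemma min_amp_bounds:
  shows "min_amp K A t > 0" and "k \<le> K \<Longrightarrow> min_amp K A t \<le> A k t"
  using amplitude_pos by (auto simp: min_amp_def intro: Min_le)

lemma min_G0_bounds:
  shows "min_G0 g \<sigma> K \<phi> t \<ge> 0" and "k \<le> K \<Longrightarrow> min_G0 g \<sigma> K \<phi> t \<le> norm (G g \<sigma> \<phi> k t 0)"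
  by (auto simp: min_G0_def intro: Min_le)

lemma sum_amp_split:
  assumes "l \<le> K"
  shows "sum_amp K A t = A l t + (\<Sum>k\<in>{0..K} - {l}. A k t)"
  using assms by (simp add: sum_amp_def sum.remove)

lemma sum_amp_ge:
  assumes "l \<le> K"
  shows "A l t \<le> sum_amp K A t"
proof -
  have "(\<Sum>k\<in>{0..K} - {l}. A k t) \<ge> 0"
    using amplitude_pos by (intro sum_nonneg) (auto intro: less_imp_le)
  then show ?thesis using sum_amp_split[OF assms] by simp
qed

text \<open>
  This makes the radii \<open>\<xi>\<^sub>k\<close> well defined: the minimal amplitude is at most the sum \<open>M\<close>, so
  dividing the smallness hypothesis by \<open>M\<close> leaves \<open>2\<tau>\<^sub>0 \<le> g\<^sub>0\<close>.
\<close>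

lemma threshold_below_peak:
  assumes "k \<le> K"
  shows "\<tau>\<^sub>0 < norm (G g \<sigma> \<phi> k t 0)"
proof -
  let ?M = "sum_amp K A t"
  have M: "min_amp K A t \<le> ?M" "?M > 0"
    using sum_amp_ge[of 0 t] min_amp_bounds(1)[of t] min_amp_bounds(2)[of 0 t] by linarith+
  have "?M * (2 * \<tau>\<^sub>0) \<le> 2 * ?M * (\<tau>\<^sub>0 + Pi0 g \<sigma> \<epsilon>\<^sub>1 \<epsilon>\<^sub>3 t)"
    using M Pi0_nonneg by (simp add: algebra_simps)
  also note small
  also have "min_G0 g \<sigma> K \<phi> t * min_amp K A t \<le> ?M * min_G0 g \<sigma> K \<phi> t"
    using M min_G0_bounds(1)[of t] by (simp add: mult_right_mono mult.commute)
  finally have "2 * \<tau>\<^sub>0 \<le> min_G0 g \<sigma> K \<phi> t" using M by simp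
  then show ?thesis using min_G0_bounds(2)[OF assms, of t] tau0_pos by linarith
qed

lemma alpha_pos: "k \<le> K \<Longrightarrow> \<alpha> k t > 0"
  using essential_radius(1)[OF tau0_pos threshold_below_peak] alpha_ge by (meson less_le_trans)

lemma abs_G_outside:
  assumes k: "k \<le> K"
  shows "\<alpha> k t \<le> \<bar>\<xi>\<bar> \<Longrightarrow> norm (G g \<sigma> \<phi> k t \<xi>) \<le> \<tau>\<^sub>0"
    and "\<alpha> k t < \<bar>\<xi>\<bar> \<Longrightarrow> norm (G g \<sigma> \<phi> k t \<xi>) < \<tau>\<^sub>0"
proof -
  note R = essential_radius[OF tau0_pos threshold_below_peak[OF k, of t]] alpha_ge[OF k, of t]
  show "norm (G g \<sigma> \<phi> k t \<xi>) \<le> \<tau>\<^sub>0" if "\<alpha> k t \<le> \<bar>\<xi>\<bar>"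
    using abs_G_le_iff[of k t \<xi> "essential_radius g \<sigma> \<phi> \<tau>\<^sub>0 k t"] R that by simp
  show "norm (G g \<sigma> \<phi> k t \<xi>) < \<tau>\<^sub>0" if "\<alpha> k t < \<bar>\<xi>\<bar>"
    using abs_G_less_iff[of k t \<xi> "essential_radius g \<sigma> \<phi> \<tau>\<^sub>0 k t"] R that by simp
qed

lemma zone_iff: "(t, \<eta>) \<in> zone \<sigma> \<phi> \<alpha> k \<longleftrightarrow> \<bar>offset k t \<eta>\<bar> < \<alpha> k t"
  using sigma_pos[of t] by (simp add: zone_def abs_mult pos_less_divide_eq mult.commute)

text \<open>
  After scaling frequencies by \<open>\<sigma>(t)\<close> the zones become disjoint intervals with radii
  \<open>\<alpha>\<^sub>k\<close> about increasing centres.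
\<close>

lemma Upsilon_le_frequency_gap:
  assumes "k \<le> K" "l \<le> K" "k \<noteq> l"
  shows "Upsilon \<alpha> t k l \<le> \<bar>\<sigma> t * (deriv (\<phi> l) t - deriv (\<phi> k) t)\<bar>"
proof -
  have gap: "Upsilon \<alpha> t k l \<le> \<sigma> t * deriv (\<phi> l) t - \<sigma> t * deriv (\<phi> k) t"
    if kl: "k < l" "l \<le> K" for k l
  proof -
    have "\<alpha> k t + \<alpha> l t + 2 * (\<Sum>j\<in>{k<..<l}. \<alpha> j t) \<le> \<sigma> t * deriv (\<phi> l) t - \<sigma> t * deriv (\<phi> k) t"
    proof (rule separated_balls_distance[of K "\<lambda>k. \<sigma> t * deriv (\<phi> k) t" "\<lambda>k. \<alpha> k t", OF _ kl])
      fix i j assume ij: "i < j" "j \<le> K"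
      show "\<sigma> t * deriv (\<phi> i) t + \<alpha> i t \<le> \<sigma> t * deriv (\<phi> j) t - \<alpha> j t"
      proof (rule disjoint_balls_separated)
        show "\<sigma> t * deriv (\<phi> i) t < \<sigma> t * deriv (\<phi> j) t"
          using frequency_strict_mono[OF ij] sigma_pos[of t] by simp
        show "\<alpha> i t > 0" "\<alpha> j t > 0" using ij alpha_pos by auto
        fix u assume u: "\<bar>u - \<sigma> t * deriv (\<phi> i) t\<bar> < \<alpha> i t"
        have off: "offset k t (u / \<sigma> t) = u - \<sigma> t * deriv (\<phi> k) t" for k
          using sigma_pos[of t] by (simp add: field_simps)
        have "(t, u / \<sigma> t) \<notin> zone \<sigma> \<phi> \<alpha> i \<inter> zone \<sigma> \<phi> \<alpha> j" using zones_disjoint[of i j] ij by simp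
        then show "\<not> \<bar>u - \<sigma> t * deriv (\<phi> j) t\<bar> < \<alpha> j t"
          using u unfolding Int_iff zone_iff off by blast
      qed
    qed
    then show ?thesis using kl by (simp add: Upsilon_def min_def max_def)
  qed
  have sym: "Upsilon \<alpha> t k l = Upsilon \<alpha> t l k" by (simp add: Upsilon_def min.commute max.commute)
  show ?thesis
    using gap[of k l] gap[of l k] assms sym
    by (cases k l rule: linorder_cases) (auto simp: right_diff_distrib)
qed

lemma Upsilon_ge:
  assumes "k \<le> K" "l \<le> K"
  shows "\<alpha> k t \<le> Upsilon \<alpha> t k l - \<alpha> l t"
proof -
  have "(\<Sum>j\<in>{min k l<..<max k l}. \<alpha> j t) \<ge> 0"
    using assms by (intro sum_nonneg less_imp_le alpha_pos) auto
  then show ?thesis by (simp add: Upsilon_def)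
qed

text \<open>
  A point of the \<open>l\<close>-th zone may be closer to the \<open>k\<close>-th frequency than the \<open>l\<close>-th
  frequency is, but by no more than the radius \<open>\<alpha>\<^sub>l/\<sigma>\<close>; hence the argument
  \<open>\<Upsilon>\<^sub>k\<^sub>l - \<alpha>\<^sub>l\<close> of \<open>G\<^sub>k\<close> in \<^const>\<open>Err\<close>.
\<close>

lemma offset_in_other_zone:
  assumes kl: "k \<le> K" "l \<le> K" "k \<noteq> l" and \<eta>: "\<bar>offset l t \<eta>\<bar> \<le> \<alpha> l t"
  shows "Upsilon \<alpha> t k l - \<alpha> l t \<le> \<bar>offset k t \<eta>\<bar>"
proof -
  have "offset k t \<eta> = offset l t \<eta> + \<sigma> t * (deriv (\<phi> l) t - deriv (\<phi> k) t)"
    by (simp add: algebra_simps)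
  then show ?thesis using Upsilon_le_frequency_gap[OF kl, of t] \<eta> by linarith
qed

lemma stft_approx_single:
  assumes l: "l \<le> K"
  shows "norm (V t \<eta> - component A \<phi> l t * G g \<sigma> \<phi> l t (offset l t \<eta>))
    \<le> sum_amp K A t * Pi0 g \<sigma> \<epsilon>\<^sub>1 \<epsilon>\<^sub>3 t
      + (\<Sum>k\<in>{0..K} - {l}. A k t * norm (G g \<sigma> \<phi> k t (offset k t \<eta>)))"
proof -
  let ?x = "\<lambda>k. component A \<phi> k t * G g \<sigma> \<phi> k t (offset k t \<eta>)"
  have split: "V t \<eta> - ?x l = (V t \<eta> - (\<Sum>k=0..K. ?x k)) + (\<Sum>k\<in>{0..K} - {l}. ?x k)"
    using l by (simp add: sum.remove)
  have "norm (V t \<eta> - ?x l) \<le> norm (V t \<eta> - (\<Sum>k=0..K. ?x k)) + norm (\<Sum>k\<in>{0..K} - {l}. ?x k)"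
    unfolding split by (rule norm_triangle_ineq)
  also have "norm (\<Sum>k\<in>{0..K} - {l}. ?x k) \<le> (\<Sum>k\<in>{0..K} - {l}. A k t * norm (G g \<sigma> \<phi> k t (offset k t \<eta>)))"
    by (rule sum_norm_le) (simp add: norm_mult norm_component)
  finally show ?thesis using stft_approx[of t \<eta>] by linarith
qed

lemma stft_approx_in_zone:
  assumes l: "l \<le> K" and \<eta>: "\<bar>offset l t \<eta>\<bar> \<le> \<alpha> l t"
  shows "norm (V t \<eta> - component A \<phi> l t * G g \<sigma> \<phi> l t (offset l t \<eta>)) \<le> Err g \<sigma> \<epsilon>\<^sub>1 \<epsilon>\<^sub>3 K A \<phi> \<alpha> l t"
proof -
  have "A k t * norm (G g \<sigma> \<phi> k t (offset k t \<eta>)) \<le> A k t * norm (G g \<sigma> \<phi> k t (Upsilon \<alpha> t k l - \<alpha> l t))"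
    if k: "k \<in> {0..K} - {l}" for k
  proof (rule mult_left_mono)
    have "0 \<le> Upsilon \<alpha> t k l - \<alpha> l t"
      using Upsilon_ge[of k l t] alpha_pos[of k t] k l by simp
    then show "norm (G g \<sigma> \<phi> k t (offset k t \<eta>)) \<le> norm (G g \<sigma> \<phi> k t (Upsilon \<alpha> t k l - \<alpha> l t))"
      unfolding abs_G_le_iff using offset_in_other_zone[of k l t \<eta>] k l \<eta> by auto
    show "0 \<le> A k t" using amplitude_pos[of k t] k by simp
  qed
  then have "(\<Sum>k\<in>{0..K} - {l}. A k t * norm (G g \<sigma> \<phi> k t (offset k t \<eta>)))
      \<le> (\<Sum>k\<in>{0..K} - {l}. A k t * norm (G g \<sigma> \<phi> k t (Upsilon \<alpha> t k l - \<alpha> l t)))"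
    by (rule sum_mono)
  then show ?thesis using stft_approx_single[OF l, of t \<eta>] unfolding Err_def by linarith
qed

lemma stft_small_outside_zones:
  assumes outside: "\<And>k. k \<le> K \<Longrightarrow> (t, \<eta>) \<notin> zone \<sigma> \<phi> \<alpha> k"
  shows "norm (V t \<eta>) \<le> sum_amp K A t * (\<tau>\<^sub>0 + Pi0 g \<sigma> \<epsilon>\<^sub>1 \<epsilon>\<^sub>3 t)"
proof -
  let ?x = "\<lambda>k. component A \<phi> k t * G g \<sigma> \<phi> k t (offset k t \<eta>)"
  have "norm (?x k) \<le> A k t * \<tau>\<^sub>0" if k: "k \<in> {0..K}" for k
  proof -
    have "norm (G g \<sigma> \<phi> k t (offset k t \<eta>)) \<le> \<tau>\<^sub>0"
      using k outside[of k] by (intro abs_G_outside(1)) (auto simp: zone_iff)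
    then show ?thesis
      using k amplitude_pos[of k t] by (simp add: norm_mult norm_component)
  qed
  then have "norm (\<Sum>k=0..K. ?x k) \<le> (\<Sum>k=0..K. A k t * \<tau>\<^sub>0)" by (rule sum_norm_le)
  also have "\<dots> = sum_amp K A t * \<tau>\<^sub>0" by (simp add: sum_amp_def sum_distrib_right)
  finally have "norm (V t \<eta>) \<le> sum_amp K A t * Pi0 g \<sigma> \<epsilon>\<^sub>1 \<epsilon>\<^sub>3 t + sum_amp K A t * \<tau>\<^sub>0"
    using stft_approx[of t \<eta>] norm_triangle_ineq2[of "V t \<eta>" "\<Sum>k=0..K. ?x k"] by linarith
  then show ?thesis by (simp add: algebra_simps)
qed

text \<open>
  The inequality is strict, as membership in the ridge set requires, because the \<open>l\<close>-th amplitude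
  is missing from the sum bounded by \<open>\<tau>\<^sub>0\<close>; hence a threshold equal to its upper bound is admitted.
\<close>

lemma stft_large_at_frequency:
  assumes l: "l \<le> K"
  shows "min_G0 g \<sigma> K \<phi> t * min_amp K A t - sum_amp K A t * (\<tau>\<^sub>0 + Pi0 g \<sigma> \<epsilon>\<^sub>1 \<epsilon>\<^sub>3 t)
    < norm (V t (deriv (\<phi> l) t))"
proof -
  let ?w = "deriv (\<phi> l) t"
  have "A k t * norm (G g \<sigma> \<phi> k t (offset k t ?w)) \<le> A k t * \<tau>\<^sub>0" if k: "k \<in> {0..K} - {l}" for k
  proof (intro mult_left_mono abs_G_outside(1))
    show "\<alpha> k t \<le> \<bar>offset k t ?w\<bar>"
      using offset_in_other_zone[of k l t ?w] Upsilon_ge[of k l t] alpha_pos[OF l, of t] k l by simp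
    show "0 \<le> A k t" using amplitude_pos[of k t] k by simp
  qed (use k in auto)
  then have "(\<Sum>k\<in>{0..K} - {l}. A k t * norm (G g \<sigma> \<phi> k t (offset k t ?w))) \<le> (\<Sum>k\<in>{0..K} - {l}. A k t * \<tau>\<^sub>0)"
    by (rule sum_mono)
  also have "\<dots> = (sum_amp K A t - A l t) * \<tau>\<^sub>0"
    by (simp add: sum_amp_split[OF l] sum_distrib_right)
  also have "\<dots> < sum_amp K A t * \<tau>\<^sub>0"
    using amplitude_pos[OF l, of t] tau0_pos by simp
  finally have "norm (V t ?w - component A \<phi> l t * G g \<sigma> \<phi> l t 0)
      < sum_amp K A t * (\<tau>\<^sub>0 + Pi0 g \<sigma> \<epsilon>\<^sub>1 \<epsilon>\<^sub>3 t)"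
    using stft_approx_single[OF l, of t ?w] by (simp add: algebra_simps)
  moreover have "min_G0 g \<sigma> K \<phi> t * min_amp K A t \<le> norm (component A \<phi> l t * G g \<sigma> \<phi> l t 0)"
    using mult_mono[OF min_G0_bounds(2)[OF l, of t] min_amp_bounds(2)[OF l, of t]]
      min_amp_bounds(1)[of t] by (simp add: norm_mult norm_component[OF l] mult.commute)
  ultimately show ?thesis
    using norm_triangle_ineq3[of "component A \<phi> l t * G g \<sigma> \<phi> l t 0" "V t ?w"]
    by (simp add: norm_minus_commute)
qed

definition deviation :: "nat \<Rightarrow> real \<Rightarrow> real"
  where "deviation l t = abs_G_inv g \<sigma> \<phi> l t
    (norm (G g \<sigma> \<phi> l t 0) - 2 * Err g \<sigma> \<epsilon>\<^sub>1 \<epsilon>\<^sub>3 K A \<phi> \<alpha> l t / A l t)"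

lemma Err_nonneg: "l \<le> K \<Longrightarrow> Err g \<sigma> \<epsilon>\<^sub>1 \<epsilon>\<^sub>3 K A \<phi> \<alpha> l t \<ge> 0"
  using stft_approx_in_zone[of l t "deriv (\<phi> l) t"] alpha_pos[of l t]
  by (simp add: order_trans[OF norm_ge_zero])

text \<open>
  Passing from \<open>V\<close> to its \<open>l\<close>-th term costs \<open>Err\<^sub>l\<close> at the frequency and again at
  \<open>\<eta>\<close>, so \<open>A\<^sub>l \<bar>G\<^sub>l\<bar>\<close> drops by at most \<open>2 Err\<^sub>l\<close> from one to the other.  The
  assumed bound on \<open>Err\<^sub>l\<close> keeps the resulting value positive, within the range where
  \<open>\<bar>G\<^sub>l\<bar>\<close> can be inverted.
\<close>

lemma peak_deviation:
  assumes l: "l \<le> K"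
    and Err_small: "Err g \<sigma> \<epsilon>\<^sub>1 \<epsilon>\<^sub>3 K A \<phi> \<alpha> l t < 1 / 2 * norm (G g \<sigma> \<phi> l t 0) * A l t"
    and \<eta>: "\<bar>offset l t \<eta>\<bar> < \<alpha> l t" and peak: "norm (V t (deriv (\<phi> l) t)) \<le> norm (V t \<eta>)"
  shows "\<bar>offset l t \<eta>\<bar> \<le> deviation l t"
proof -
  define E where "E = Err g \<sigma> \<epsilon>\<^sub>1 \<epsilon>\<^sub>3 K A \<phi> \<alpha> l t"
  define y where "y = norm (G g \<sigma> \<phi> l t 0) - 2 * E / A l t"
  have A: "A l t > 0" by (rule amplitude_pos[OF l])
  have "0 < y" "y \<le> norm (G g \<sigma> \<phi> l t 0)"
    using Err_small Err_nonneg[OF l, of t] A by (simp_all add: y_def E_def[symmetric] field_simps)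
  note inv = abs_G_inv[OF this]
  have near: "norm (V t u - component A \<phi> l t * G g \<sigma> \<phi> l t (offset l t u)) \<le> E"
    if "\<bar>offset l t u\<bar> < \<alpha> l t" for u
    unfolding E_def using that by (intro stft_approx_in_zone[OF l]) simp
  have "A l t * norm (G g \<sigma> \<phi> l t 0) - E \<le> norm (V t (deriv (\<phi> l) t))"
    using near[of "deriv (\<phi> l) t"] alpha_pos[OF l, of t]
      norm_triangle_ineq2[of "component A \<phi> l t * G g \<sigma> \<phi> l t 0" "V t (deriv (\<phi> l) t)"]
    by (simp add: norm_minus_commute norm_mult norm_component[OF l])
  also note peak
  also have "norm (V t \<eta>) \<le> A l t * norm (G g \<sigma> \<phi> l t (offset l t \<eta>)) + E"
    using near[OF \<eta>] norm_triangle_ineq2[of "V t \<eta>" "component A \<phi> l t * G g \<sigma> \<phi> l t (offset l t \<eta>)"]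
    by (simp add: norm_mult norm_component[OF l])
  finally have "y \<le> norm (G g \<sigma> \<phi> l t (offset l t \<eta>))"
    using A by (simp add: y_def field_simps)
  then have "norm (G g \<sigma> \<phi> l t (abs_G_inv g \<sigma> \<phi> l t y)) \<le> norm (G g \<sigma> \<phi> l t (offset l t \<eta>))"
    by (simp only: inv(2))
  then have "\<bar>offset l t \<eta>\<bar> \<le> \<bar>abs_G_inv g \<sigma> \<phi> l t y\<bar>" by (simp only: abs_G_le_iff)
  then show ?thesis using inv(1) by (simp add: deviation_def y_def E_def)
qed

lemma component_recovery:
  assumes l: "l \<le> K" and \<eta>: "\<bar>offset l t \<eta>\<bar> < \<alpha> l t" and dev: "\<bar>offset l t \<eta>\<bar> \<le> d"
  shows "norm (V t \<eta> - G g \<sigma> \<phi> l t 0 * component A \<phi> l t)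
    \<le> Err g \<sigma> \<epsilon>\<^sub>1 \<epsilon>\<^sub>3 K A \<phi> \<alpha> l t + 2 * pi * abs_moment g 1 * A l t * d"
proof -
  let ?x = "component A \<phi> l t"
  have A: "A l t > 0" by (rule amplitude_pos[OF l])
  have split: "V t \<eta> - G g \<sigma> \<phi> l t 0 * ?x = (V t \<eta> - ?x * G g \<sigma> \<phi> l t (offset l t \<eta>))
      + ?x * (G g \<sigma> \<phi> l t (offset l t \<eta>) - G g \<sigma> \<phi> l t 0)"
    by (simp add: algebra_simps)
  have "norm (V t \<eta> - G g \<sigma> \<phi> l t 0 * ?x) \<le> norm (V t \<eta> - ?x * G g \<sigma> \<phi> l t (offset l t \<eta>))
      + A l t * norm (G g \<sigma> \<phi> l t (offset l t \<eta>) - G g \<sigma> \<phi> l t 0)"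
    unfolding split by (rule order.trans[OF norm_triangle_ineq]) (simp add: norm_mult norm_component[OF l])
  also have "norm (V t \<eta> - ?x * G g \<sigma> \<phi> l t (offset l t \<eta>)) \<le> Err g \<sigma> \<epsilon>\<^sub>1 \<epsilon>\<^sub>3 K A \<phi> \<alpha> l t"
    using \<eta> by (intro stft_approx_in_zone[OF l]) simp
  also have "A l t * norm (G g \<sigma> \<phi> l t (offset l t \<eta>) - G g \<sigma> \<phi> l t 0)
      \<le> A l t * (2 * pi * d * abs_moment g 1)"
  proof (rule mult_left_mono)
    have "norm (G g \<sigma> \<phi> l t (offset l t \<eta>) - G g \<sigma> \<phi> l t 0) \<le> 2 * pi * \<bar>offset l t \<eta>\<bar> * abs_moment g 1"
      using G_lipschitz[of l t "offset l t \<eta>" 0] by simp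
    also have "\<dots> \<le> 2 * pi * d * abs_moment g 1"
      by (intro mult_right_mono mult_left_mono dev) (simp_all add: abs_moment_def)
    finally show "norm (G g \<sigma> \<phi> l t (offset l t \<eta>) - G g \<sigma> \<phi> l t 0) \<le> 2 * pi * d * abs_moment g 1" .
  qed (use A in simp)
  finally show ?thesis by (simp add: mult_ac)
qed

end

theorem theorem2:
  fixes K :: nat
    and A \<phi> \<alpha> etac :: "nat \<Rightarrow> real \<Rightarrow> real"
    and x g :: "real \<Rightarrow> complex"
    and \<sigma> thr :: "real \<Rightarrow> real"
    and \<epsilon>\<^sub>1 \<epsilon>\<^sub>3 \<tau>\<^sub>0 :: real
  assumes eps_pos: "\<epsilon>\<^sub>1 > 0" "\<epsilon>\<^sub>3 > 0"
    and x_class: "signal_class \<epsilon>\<^sub>1 \<epsilon>\<^sub>3 K A \<phi>"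
    and x_def: "x = signal K A \<phi>"
    and window: "admissible_window g"
    and window_integral: "(LINT \<tau>|lebesgue. g \<tau>) = 1"
    and window_moments: "finite_abs_moment g 1" "finite_abs_moment g 3"
    and tau0: "0 < \<tau>\<^sub>0" "\<tau>\<^sub>0 < 1"
    and sigma_pos: "\<forall>t. \<sigma> t > 0"
    and alpha_ge: "\<forall>k\<in>{0..K}. \<forall>t. \<alpha> k t \<ge> essential_radius g \<sigma> \<phi> \<tau>\<^sub>0 k t"
    and zones_disjoint:
      "\<forall>k\<in>{0..K}. \<forall>l\<in>{0..K}. k \<noteq> l \<longrightarrow> zone \<sigma> \<phi> \<alpha> k \<inter> zone \<sigma> \<phi> \<alpha> l = {}"
    and Err_small: "\<forall>t. \<forall>l\<in>{0..K}.
      Err g \<sigma> \<epsilon>\<^sub>1 \<epsilon>\<^sub>3 K A \<phi> \<alpha> l t < 1 / 2 * norm (G g \<sigma> \<phi> l t 0) * A l t"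
    and small: "\<forall>t. 2 * sum_amp K A t * (\<tau>\<^sub>0 + Pi0 g \<sigma> \<epsilon>\<^sub>1 \<epsilon>\<^sub>3 t) \<le> min_G0 g \<sigma> K \<phi> t * min_amp K A t"
    and thr_pos: "\<forall>t. thr t > 0"
    and thr_lower: "\<forall>t. sum_amp K A t * (\<tau>\<^sub>0 + Pi0 g \<sigma> \<epsilon>\<^sub>1 \<epsilon>\<^sub>3 t) \<le> thr t"
    and thr_upper: "\<forall>t. thr t \<le>
      min_G0 g \<sigma> K \<phi> t * min_amp K A t - sum_amp K A t * (\<tau>\<^sub>0 + Pi0 g \<sigma> \<epsilon>\<^sub>1 \<epsilon>\<^sub>3 t)"
  shows "\<forall>t.
    (ridge_set g \<sigma> x thr t = (\<Union>k\<in>{0..K}. ridge_zone g \<sigma> x thr \<phi> \<alpha> t k) \<and>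
     disjoint_family_on (ridge_zone g \<sigma> x thr \<phi> \<alpha> t) {0..K} \<and>
     (\<forall>k\<in>{0..K}. ridge_zone g \<sigma> x thr \<phi> \<alpha> t k \<noteq> {})) \<and>
    (is_ridges g \<sigma> x thr K \<phi> \<alpha> etac t \<longrightarrow>
     (\<forall>l\<in>{1..K}.
        \<bar>etac l t - deriv (\<phi> l) t\<bar> \<le> 1 / \<sigma> t *
          abs_G_inv g \<sigma> \<phi> l t
            (norm (G g \<sigma> \<phi> l t 0) - 2 * Err g \<sigma> \<epsilon>\<^sub>1 \<epsilon>\<^sub>3 K A \<phi> \<alpha> l t / A l t)) \<and>
     (\<forall>l\<in>{0..K}.
        norm (adaptive_stft g \<sigma> x t (etac l t) - G g \<sigma> \<phi> l t 0 * component A \<phi> l t) \<le>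
          Err g \<sigma> \<epsilon>\<^sub>1 \<epsilon>\<^sub>3 K A \<phi> \<alpha> l t +
          2 * pi * abs_moment g 1 * A l t *
            abs_G_inv g \<sigma> \<phi> l t
              (norm (G g \<sigma> \<phi> l t 0) - 2 * Err g \<sigma> \<epsilon>\<^sub>1 \<epsilon>\<^sub>3 K A \<phi> \<alpha> l t / A l t)))"
    (is "\<forall>t. ?concl t")
proof -
  interpret ridge_setting \<epsilon>\<^sub>1 \<epsilon>\<^sub>3 K A \<phi> g \<sigma> \<tau>\<^sub>0 \<alpha>
    using eps_pos x_class window window_moments tau0 sigma_pos alpha_ge zones_disjoint small
    by unfold_locales auto
  show ?thesis
  proof (rule allI)
    fix t
    let ?H = "ridge_zone g \<sigma> x thr \<phi> \<alpha> t"
    have in_H: "\<eta> \<in> ?H k \<longleftrightarrow> thr t < norm (V t \<eta>) \<and> (t, \<eta>) \<in> zone \<sigma> \<phi> \<alpha> k" for k \<eta>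
      by (simp add: ridge_zone_def ridge_set_def zone_def x_def)
    have frequency_in_H: "deriv (\<phi> k) t \<in> ?H k" if "k \<le> K" for k
      unfolding in_H zone_iff
      using stft_large_at_frequency[OF that, of t] thr_upper[rule_format, of t] alpha_pos[OF that, of t]
      by simp
    have "ridge_set g \<sigma> x thr t \<subseteq> (\<Union>k\<in>{0..K}. ?H k)"
    proof
      fix \<eta> assume "\<eta> \<in> ridge_set g \<sigma> x thr t"
      then have large: "thr t < norm (V t \<eta>)" by (simp add: ridge_set_def x_def)
      have "\<not> (\<forall>k\<le>K. (t, \<eta>) \<notin> zone \<sigma> \<phi> \<alpha> k)"
        using stft_small_outside_zones[of t \<eta>] thr_lower[rule_format, of t] large by fastforce
      then show "\<eta> \<in> (\<Union>k\<in>{0..K}. ?H k)" using large by (auto simp: in_H)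
    qed
    then have "ridge_set g \<sigma> x thr t = (\<Union>k\<in>{0..K}. ?H k)"
      by (auto simp: ridge_zone_def)
    moreover have "disjoint_family_on ?H {0..K}"
      unfolding disjoint_family_on_def using zones_disjoint by (fastforce simp: in_H)
    moreover have "\<forall>k\<in>{0..K}. ?H k \<noteq> {}" using frequency_in_H by fastforce
    moreover have "(\<forall>l\<in>{1..K}. \<bar>etac l t - deriv (\<phi> l) t\<bar> \<le> 1 / \<sigma> t * deviation l t) \<and>
        (\<forall>l\<in>{0..K}. norm (adaptive_stft g \<sigma> x t (etac l t) - G g \<sigma> \<phi> l t 0 * component A \<phi> l t)
          \<le> Err g \<sigma> \<epsilon>\<^sub>1 \<epsilon>\<^sub>3 K A \<phi> \<alpha> l t + 2 * pi * abs_moment g 1 * A l t * deviation l t)"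
      if ridges: "is_ridges g \<sigma> x thr K \<phi> \<alpha> etac t"
    proof -
      have peak: "\<bar>offset l t (etac l t)\<bar> < \<alpha> l t \<and> norm (V t (deriv (\<phi> l) t)) \<le> norm (V t (etac l t))"
        if l: "l \<le> K" for l
      (* The trend is not searched for: its frequency 0 is prescribed, so it is its own competitor. *)
      proof (cases "l = 0")
        case True
        then have "etac l t = deriv (\<phi> l) t"
          using ridges trend_phase by (simp add: is_ridges_def)
        then show ?thesis using alpha_pos[OF l, of t] by simp
      next
        case False
        then have "is_arg_max (\<lambda>\<eta>. norm (V t \<eta>)) (\<lambda>\<eta>. \<eta> \<in> ?H l) (etac l t)"
          using ridges l by (simp add: is_ridges_def x_def)
        then show ?thesis
          using frequency_in_H[OF l] unfolding is_arg_max_linorder in_H zone_iff by blast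
      qed
      have dev: "\<bar>offset l t (etac l t)\<bar> \<le> deviation l t" if "l \<le> K" for l
        using peak[OF that] Err_small that by (intro peak_deviation) auto
      have "\<bar>etac l t - deriv (\<phi> l) t\<bar> \<le> 1 / \<sigma> t * deviation l t" if "l \<le> K" for l
        using dev[OF that] sigma_pos[rule_format, of t] by (simp add: abs_mult pos_le_divide_eq mult.commute)
      moreover have "norm (V t (etac l t) - G g \<sigma> \<phi> l t 0 * component A \<phi> l t)
          \<le> Err g \<sigma> \<epsilon>\<^sub>1 \<epsilon>\<^sub>3 K A \<phi> \<alpha> l t + 2 * pi * abs_moment g 1 * A l t * deviation l t" if "l \<le> K" for l
        using peak[OF that] dev[OF that] that by (intro component_recovery) auto
      ultimately show ?thesis by (simp add: x_def)
    qed
    ultimately show "?concl t" unfolding deviation_def by blast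
  qed
qed

end
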